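(* Suppose the regularity assumption and the unique strict-interior optimizer assumption (with optimizer $x^\star$) hold, and suppose that $f$ is $\mu$-strongly geodesically convex along the admissible minimizing geodesics in $\mathcal X$ for some $\mu>0$. Then, for every $x\in\mathcal X$, $$d(x,x^\star)\le\sqrt{\frac{2h(x)}{\mu}}.$$ Thus the Hölderian error bound $d(x,\mathcal X^\star)\le c\,h(x)^\theta$ holds for all $x\in\mathcal X$ with $c=\sqrt{2/\mu}$ and $\theta=1/2$. Consequently, for every $a>2$, RFW-OL($a$) either terminates at $x^\star$ or satisfies $$f(x_k)-f^\star=O(1/k^2).$$
   Context: Setting. $\mathcal M$ is a connected, complete, finite-dimensional Riemannian manifold with distance $d$, tangent spaces $T_x\mathcal M$, inner products $\langle\cdot,\cdot\rangle_x$, norms $\|\cdot\|_x$ and exponential map $\operatorname{Exp}_x$. The set $\mathcal X\subset\mathcal M$ is nonempty and compact, with diameter $D:=\sup_{x,y\in\mathcal X}d(x,y)>0$, and is weakly minimizing-geodesically convex: for all $x,y\in\mathcal X$ there is at least one distance-minimizing geodesic from $x$ to $y$ whose image is contained in $\mathcal X$. For $x\in\mathcal X$ the set of feasible minimizing initial velocities is $$\mathcal V(x):=\{v\in T_x\mathcal M:\ \operatorname{Exp}_x(v)\in\mathcal X,\ \|v\|_x=d(x,\operatorname{Exp}_x(v)),\ \operatorname{Exp}_x(tv)\in\mathcal X\ \text{for all }t\in[0,1]\}.$$ The function $f$ is real-valued and differentiable on an open neighborhood of $\mathcal X$, with Riemannian gradient $\operatorname{grad}f$. Put $f^\star:=\min_{\mathcal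 X}f$, $\mathcal X^\star:=\arg\min_{\mathcal X}f$, $h(x):=f(x)-f^\star$. Regularity assumption (constant $L>0$): for all $x\in\mathcal X$, $v\in\mathcal V(x)$, $t\in[0,1]$, $f(\operatorname{Exp}_x(tv))\le(1-t)f(x)+tf(\operatorname{Exp}_x(v))$ and $f(\operatorname{Exp}_x(tv))\le f(x)+t\langle\operatorname{grad}f(x),v\rangle_x+\frac L2t^2\|v\|_x^2$. Unique strict-interior optimizer assumption: $\mathcal X^\star=\{x^\star\}$ and there is $\beta>0$ such that the closed Riemannian ball $\{y\in\mathcal M:d(x^\star,y)\le\beta\}$ is contained in $\mathcal X$. $\mu$-strong geodesic convexity along admissible minimizing geodesics: for all $x\in\mathcal X$, $v\in\mathcal V(x)$, $t\in[0,1]$, $f(\operatorname{Exp}_x(tv))\le(1-t)f(x)+tf(\operatorname{Exp}_x(v))-\frac\mu2t(1-t)\|v\|_x^2$. Algorithm RFW-OL($a$). Start from an arbitrary $x_0\in\mathcal X$. For $k=0,1,2,\dots$: choose any $v_k\in\arg\min_{v\in\mathcal V(x_k)}\langle\operatorname{grad}f(x_k),v\rangle_{x_k}$, set $g_k:=-\langle\operatorname{grad}f(x_k),v_k\rangle_{x_k}$; if $g_k=0$, terminate and return $x_k$; otherwise set $\eta_k:=a/(k+a)$ and $x_{k+1}:=\operatorname{Exp}_{x_k}(\eta_kv_k)$. *)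

theory Defs
  imports "HOL-Analysis.Analysis" "HOL-Library.Landau_Symbols"
begin

section \<open>Smooth maps between Euclidean spaces\<close>

text \<open>Only used on open sets. The clause for \<^term>\<open>Suc n\<close> asks all directional derivatives to be
  \<open>n\<close> times continuously differentiable.\<close>

primrec Ck_on :: "nat \<Rightarrow> 'a::euclidean_space set \<Rightarrow> ('a \<Rightarrow> 'b::real_normed_vector) \<Rightarrow> bool" where
  "Ck_on 0 S f \<longleftrightarrow> continuous_on S f"
| "Ck_on (Suc n) S f \<longleftrightarrow>
     (\<forall>z\<in>S. f differentiable at z) \<and> (\<forall>u. Ck_on n S (\<lambda>z. frechet_derivative f (at z) u))"

definition smooth_on :: "'a::euclidean_space set \<Rightarrow> ('a \<Rightarrow> 'b::real_normed_vector) \<Rightarrow> bool" where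
  "smooth_on S f \<longleftrightarrow> (\<forall>n. Ck_on n S f)"

section \<open>Riemannian manifolds\<close>

text \<open>
  The points of the manifold are the elements of the type \<open>'m\<close>, the model space is \<open>'e\<close>. The
  atlas is given as a family of charts, one distinguished chart around every point:
  \<open>chart_dom M p\<close> is
  the domain and \<open>chart M p\<close> the coordinate map of the chart around \<open>p\<close>. Every smooth atlas
  contains such a family, and any such family is itself a smooth atlas.

  The distinguished chart around \<open>p\<close> identifies the tangent space at \<open>p\<close> with \<open>'e\<close>: a tangent
  vector at \<open>p\<close> is represented by its components in the chart around \<open>p\<close>. In particular
  \<open>metric M p u w\<close> is the inner product of the tangent vectors at \<open>p\<close> with components \<open>u\<close>, \<open>w\<close>
  in that chart.
\<close>

record ('m, 'e) riem =
  chart_dom :: "'m \<Rightarrow> 'm set"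
  chart :: "'m \<Rightarrow> 'm \<Rightarrow> 'e"
  metric :: "'m \<Rightarrow> 'e \<Rightarrow> 'e \<Rightarrow> real"

definition chart_inv :: "('m, 'e) riem \<Rightarrow> 'm \<Rightarrow> 'e \<Rightarrow> 'm" where
  "chart_inv M p = inv_into (chart_dom M p) (chart M p)"

definition transition :: "('m, 'e) riem \<Rightarrow> 'm \<Rightarrow> 'm \<Rightarrow> 'e \<Rightarrow> 'e" where
  "transition M p q = chart M q \<circ> chart_inv M p"

definition smooth_manifold ::
  "('m::{t2_space, second_countable_topology}, 'e::euclidean_space) riem \<Rightarrow> bool" where
  "smooth_manifold M \<longleftrightarrow>
     (\<forall>p. p \<in> chart_dom M p \<and> open (chart_dom M p) \<and> open (chart M p ` chart_dom M p) \<and>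
          homeomorphism (chart_dom M p) (chart M p ` chart_dom M p) (chart M p) (chart_inv M p)) \<and>
     (\<forall>p q. smooth_on (chart M p ` (chart_dom M p \<inter> chart_dom M q)) (transition M p q))"

text \<open>The metric tensor in the chart around \<open>p\<close>, at the point with coordinates \<open>z\<close>: vectors are
  transported by the differential of the change of coordinates to the distinguished chart of the
  point itself.\<close>

definition coord_metric ::
  "('m, 'e::euclidean_space) riem \<Rightarrow> 'm \<Rightarrow> 'e \<Rightarrow> 'e \<Rightarrow> 'e \<Rightarrow> real" where
  "coord_metric M p z u w =
     (let q = chart_inv M p z; T = frechet_derivative (transition M p q) (at z)
      in metric M q (T u) (T w))"

definition riemannian_manifold ::
  "('m::{t2_space, second_countable_topology}, 'e::euclidean_space) riem \<Rightarrow> bool" where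
  "riemannian_manifold M \<longleftrightarrow>
     smooth_manifold M \<and>
     (\<forall>p. bilinear (metric M p) \<and> (\<forall>u w. metric M p u w = metric M p w u) \<and>
          (\<forall>u. u \<noteq> 0 \<longrightarrow> metric M p u u > 0)) \<and>
     (\<forall>p u w. smooth_on (chart M p ` chart_dom M p) (\<lambda>z. coord_metric M p z u w))"

definition tnorm :: "('m, 'e) riem \<Rightarrow> 'm \<Rightarrow> 'e \<Rightarrow> real" where
  "tnorm M x v = sqrt (metric M x v v)"

section \<open>Curves, length and Riemannian distance\<close>

definition velocity ::
  "('m, 'e::euclidean_space) riem \<Rightarrow> real set \<Rightarrow> (real \<Rightarrow> 'm) \<Rightarrow> real \<Rightarrow> 'e" where
  "velocity M J \<gamma> t = vector_derivative (chart M (\<gamma> t) \<circ> \<gamma>) (at t within J)"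

text \<open>Continuously differentiable up to the end points of the interval \<open>J\<close>, in every chart; \<open>c'\<close>
  is the derivative of the coordinate representation, relevant only while the curve is in the
  chart.\<close>

definition C1_curve_on ::
  "('m::topological_space, 'e::euclidean_space) riem \<Rightarrow> real set \<Rightarrow> (real \<Rightarrow> 'm) \<Rightarrow> bool" where
  "C1_curve_on M J \<gamma> \<longleftrightarrow>
     continuous_on J \<gamma> \<and>
     (\<forall>p. \<exists>c'. \<forall>t\<in>J. \<gamma> t \<in> chart_dom M p \<longrightarrow>
        ((chart M p \<circ> \<gamma>) has_vector_derivative c' t) (at t within J) \<and>
        continuous (at t within J) c')"

text \<open>Curves on the unit interval that are C1 on each closed piece between consecutive break
  points \<open>S\<close>.\<close>

definition piecewise_C1_curve ::
  "('m::topological_space, 'e::euclidean_space) riem \<Rightarrow> (real \<Rightarrow> 'm) \<Rightarrow> bool" where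
  "piecewise_C1_curve M \<gamma> \<longleftrightarrow>
     continuous_on {0..1} \<gamma> \<and>
     (\<exists>S. finite S \<and>
        (\<forall>a b. 0 \<le> a \<and> a < b \<and> b \<le> 1 \<and> {a<..<b} \<inter> S = {} \<longrightarrow> C1_curve_on M {a..b} \<gamma>))"

definition curve_length ::
  "('m, 'e::euclidean_space) riem \<Rightarrow> (real \<Rightarrow> 'm) \<Rightarrow> real" where
  "curve_length M \<gamma> = integral {0..1} (\<lambda>t. tnorm M (\<gamma> t) (velocity M {0..1} \<gamma> t))"

definition riem_dist ::
  "('m::topological_space, 'e::euclidean_space) riem \<Rightarrow> 'm \<Rightarrow> 'm \<Rightarrow> real" where
  "riem_dist M x y =
     Inf {curve_length M \<gamma> | \<gamma>. piecewise_C1_curve M \<gamma> \<and> \<gamma> 0 = x \<and> \<gamma> 1 = y}"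

definition complete_manifold ::
  "('m::topological_space, 'e::euclidean_space) riem \<Rightarrow> bool" where
  "complete_manifold M \<longleftrightarrow> Metric_space.mcomplete UNIV (riem_dist M)"

section \<open>Geodesics and the exponential map\<close>

text \<open>Christoffel symbols of the first kind of the Levi-Civita connection in the chart around \<open>p\<close>
  (with the last index lowered).\<close>

definition christoffel ::
  "('m, 'e::euclidean_space) riem \<Rightarrow> 'm \<Rightarrow> 'e \<Rightarrow> 'e \<Rightarrow> 'e \<Rightarrow> 'e \<Rightarrow> real" where
  "christoffel M p z u v w =
     (frechet_derivative (\<lambda>y. coord_metric M p y v w) (at z) u
    + frechet_derivative (\<lambda>y. coord_metric M p y u w) (at z) v
    - frechet_derivative (\<lambda>y. coord_metric M p y u v) (at z) w) / 2"

text \<open>The covariant acceleration vanishes in every chart: its inner product with every vector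
  \<open>w\<close> is zero. Here \<open>c'\<close> and \<open>c''\<close> are the first two derivatives of the coordinate representation
  (one-sided at end points of \<open>J\<close>).\<close>

definition geodesic_on ::
  "('m::topological_space, 'e::euclidean_space) riem \<Rightarrow> real set \<Rightarrow> (real \<Rightarrow> 'm) \<Rightarrow> bool" where
  "geodesic_on M J \<gamma> \<longleftrightarrow>
     continuous_on J \<gamma> \<and>
     (\<forall>p. \<exists>c' c''. \<forall>t\<in>J. \<gamma> t \<in> chart_dom M p \<longrightarrow>
        ((chart M p \<circ> \<gamma>) has_vector_derivative c' t) (at t within J) \<and>
        (c' has_vector_derivative c'' t) (at t within J) \<and>
        (\<forall>w. coord_metric M p (chart M p (\<gamma> t)) (c'' t) w
              + christoffel M p (chart M p (\<gamma> t)) (c' t) (c' t) w = 0))"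

text \<open>Geodesics are determined by their initial velocity, and on a complete manifold one exists
  for every initial velocity, so the description is proper there.\<close>

definition Exp ::
  "('m::topological_space, 'e::euclidean_space) riem \<Rightarrow> 'm \<Rightarrow> 'e \<Rightarrow> 'm" where
  "Exp M x v =
     (THE y. \<exists>\<gamma>. geodesic_on M {0..1} \<gamma> \<and> \<gamma> 0 = x \<and> velocity M {0..1} \<gamma> 0 = v \<and> \<gamma> 1 = y)"

definition minimizing_geodesic ::
  "('m::topological_space, 'e::euclidean_space) riem \<Rightarrow> 'm \<Rightarrow> 'm \<Rightarrow> (real \<Rightarrow> 'm) \<Rightarrow> bool" where
  "minimizing_geodesic M x y \<gamma> \<longleftrightarrow>
     geodesic_on M {0..1} \<gamma> \<and> \<gamma> 0 = x \<and> \<gamma> 1 = y \<and> curve_length M \<gamma> = riem_dist M x y"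

section \<open>Differentiable functions and the Riemannian gradient\<close>

definition differentiable_at ::
  "('m, 'e::euclidean_space) riem \<Rightarrow> ('m \<Rightarrow> real) \<Rightarrow> 'm \<Rightarrow> bool" where
  "differentiable_at M f x \<longleftrightarrow> (f \<circ> chart_inv M x) differentiable at (chart M x x)"

definition differential ::
  "('m, 'e::euclidean_space) riem \<Rightarrow> ('m \<Rightarrow> real) \<Rightarrow> 'm \<Rightarrow> 'e \<Rightarrow> real" where
  "differential M f x v = frechet_derivative (f \<circ> chart_inv M x) (at (chart M x x)) v"

definition grad ::
  "('m, 'e::euclidean_space) riem \<Rightarrow> ('m \<Rightarrow> real) \<Rightarrow> 'm \<Rightarrow> 'e" where
  "grad M f x = (THE g. \<forall>v. metric M x g v = differential M f x v)"

section \<open>The constrained optimization problem\<close>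

definition diam ::
  "('m::topological_space, 'e::euclidean_space) riem \<Rightarrow> 'm set \<Rightarrow> real" where
  "diam M X = Sup {riem_dist M x y | x y. x \<in> X \<and> y \<in> X}"

definition weakly_geodesically_convex ::
  "('m::topological_space, 'e::euclidean_space) riem \<Rightarrow> 'm set \<Rightarrow> bool" where
  "weakly_geodesically_convex M X \<longleftrightarrow>
     (\<forall>x\<in>X. \<forall>y\<in>X. \<exists>\<gamma>. minimizing_geodesic M x y \<gamma> \<and> \<gamma> ` {0..1} \<subseteq> X)"

definition feasible_velocities ::
  "('m::topological_space, 'e::euclidean_space) riem \<Rightarrow> 'm set \<Rightarrow> 'm \<Rightarrow> 'e set" where
  "feasible_velocities M X x =
     {v. Exp M x v \<in> X \<and> tnorm M x v = riem_dist M x (Exp M x v) \<and>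
         (\<forall>t\<in>{0..1}. Exp M x (t *\<^sub>R v) \<in> X)}"

definition fmin :: "'m set \<Rightarrow> ('m \<Rightarrow> real) \<Rightarrow> real" where
  "fmin X f = (INF x\<in>X. f x)"

definition argmin_set :: "'m set \<Rightarrow> ('m \<Rightarrow> real) \<Rightarrow> 'm set" where
  "argmin_set X f = {x. is_arg_min f (\<lambda>y. y \<in> X) x}"

definition regularity ::
  "('m::topological_space, 'e::euclidean_space) riem \<Rightarrow> 'm set \<Rightarrow> ('m \<Rightarrow> real) \<Rightarrow> real \<Rightarrow> bool" where
  "regularity M X f L \<longleftrightarrow>
     (\<forall>x\<in>X. \<forall>v\<in>feasible_velocities M X x. \<forall>t\<in>{0..1}.
        f (Exp M x (t *\<^sub>R v)) \<le> (1 - t) * f x + t * f (Exp M x v) \<and>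
        f (Exp M x (t *\<^sub>R v))
          \<le> f x + t * metric M x (grad M f x) v + L / 2 * t\<^sup>2 * (tnorm M x v)\<^sup>2)"

definition strongly_geodesically_convex ::
  "('m::topological_space, 'e::euclidean_space) riem \<Rightarrow> 'm set \<Rightarrow> ('m \<Rightarrow> real) \<Rightarrow> real \<Rightarrow> bool" where
  "strongly_geodesically_convex M X f \<mu> \<longleftrightarrow>
     (\<forall>x\<in>X. \<forall>v\<in>feasible_velocities M X x. \<forall>t\<in>{0..1}.
        f (Exp M x (t *\<^sub>R v))
          \<le> (1 - t) * f x + t * f (Exp M x v) - \<mu> / 2 * t * (1 - t) * (tnorm M x v)\<^sup>2)"

definition hoelder_error_bound ::
  "('m::topological_space, 'e::euclidean_space) riem \<Rightarrow> 'm set \<Rightarrow> ('m \<Rightarrow> real) \<Rightarrow> real \<Rightarrow> real \<Rightarrow> bool" where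
  "hoelder_error_bound M X f c \<theta> \<longleftrightarrow>
     (\<forall>x\<in>X. (INF y\<in>argmin_set X f. riem_dist M x y) \<le> c * (f x - fmin X f) powr \<theta>)"

section \<open>Riemannian Frank-Wolfe with open-loop step sizes\<close>

text \<open>\<open>x\<close> are the iterates and \<open>v\<close> the chosen directions of an execution of the algorithm.
  \<open>N\<close> is the index of the iterate at which it terminates, or \<open>\<infinity>\<close> if it does not terminate; the
  values of \<open>x\<close> and \<open>v\<close> at indices beyond \<open>N\<close> are irrelevant.\<close>

definition fw_gap ::
  "('m, 'e::euclidean_space) riem \<Rightarrow> ('m \<Rightarrow> real) \<Rightarrow> 'm \<Rightarrow> 'e \<Rightarrow> real" where
  "fw_gap M f x v = - metric M x (grad M f x) v"

definition rfw_ol_run ::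
  "('m::topological_space, 'e::euclidean_space) riem \<Rightarrow> 'm set \<Rightarrow> ('m \<Rightarrow> real) \<Rightarrow> real
    \<Rightarrow> (nat \<Rightarrow> 'm) \<Rightarrow> (nat \<Rightarrow> 'e) \<Rightarrow> enat \<Rightarrow> bool" where
  "rfw_ol_run M X f a x v N \<longleftrightarrow>
     x 0 \<in> X \<and>
     (\<forall>k. enat k \<le> N \<longrightarrow>
        is_arg_min (\<lambda>w. metric M (x k) (grad M f (x k)) w)
          (\<lambda>w. w \<in> feasible_velocities M X (x k)) (v k)) \<and>
     (\<forall>k. enat k < N \<longrightarrow>
        fw_gap M f (x k) (v k) \<noteq> 0 \<and>
        x (Suc k) = Exp M (x k) ((a / (real k + a)) *\<^sub>R v k)) \<and>
     (\<forall>k. enat k = N \<longrightarrow> fw_gap M f (x k) (v k) = 0)"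

end

theory Submission
  imports Defs
begin

text \<open>
  Strong convexity along a minimizing geodesic from \<open>x\<close> to the optimizer gives quadratic growth, and
  regularity bounds the optimality gap \<open>h x\<close> by the Frank-Wolfe gap; this alone yields \<open>h (x k) \<rightarrow> 0\<close>, so
  that the iterates enter every neighbourhood of the optimizer. Near the optimizer the Frank-Wolfe gap
  is bounded below by a multiple of the norm of the gradient, hence, by quadratic growth, by a multiple
  of \<open>sqrt (h x)\<close>, and combining the two lower bounds in the descent inequality gives the rate
  \<open>O(1 / k\<^sup>2)\<close>.

  The gradient bound needs neither a uniform injectivity radius nor the existence of geodesics: since
  any two points of \<open>X\<close> are joined by a minimizing geodesic, one may take the geodesic to a
  point at small coordinate distance \<open>\<epsilon>\<close> in the direction of steepest descent. In coordinates its
  acceleration is quadratic in its speed, so its initial velocity differs from the coordinate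
  displacement by \<open>O(\<epsilon>\<^sup>2)\<close> only. From the theory of geodesics this uses constancy of the speed and
  uniqueness (for the evaluation of the exponential map).
\<close>

section \<open>Charts and the metric in coordinates\<close>

text \<open>Two lower bounds for the gap \<open>g\<close> are needed because the error in the
  descent inequality is \<open>C * \<eta>\<^sup>2\<close> with \<open>\<eta> = a / (k + a)\<close>.
  From \<open>h \<le> g\<close> alone, the decrease \<open>\<eta> * h\<close> balances this error
  only for \<open>h\<close> of order 1/k. A bound \<open>c * sqrt h \<le> g\<close> is stronger for
  small \<open>h\<close>: for \<open>h\<close> of order B/k^2 the decrease
  \<open>\<eta> * sqrt h\<close> is itself of order 1/k^2 and absorbs the error once B is large. The
  square root arises from a slope. The direction from \<open>x\<close> to the optimizer loses at
  least \<open>h\<close> over a length of at most \<open>sqrt (2 * h / \<mu>)\<close>, so its slope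
  per unit length is at least \<open>sqrt (\<mu> * h / 2)\<close>. The direction itself is short
  near the optimizer; the interior ball supplies one of length bounded below that realises a fixed
  fraction of the best slope. Closeness to the optimizer is read off from values of
  \<open>f\<close>: compactness turns \<open>h\<close> tending to 0 into entry into an open set, and
  strong convexity bounds all feasible velocities by the range of \<open>f\<close> on
  \<open>X\<close>.\<close>

lemma norm_le_sum_Basis:
  fixes u :: "'a::euclidean_space" and F :: "'a \<Rightarrow> 'b::real_normed_vector"
  assumes "linear F"
  shows "norm (F u) \<le> (\<Sum>b\<in>Basis. norm (F b)) * norm u"
proof -
  have "F u = F (\<Sum>b\<in>Basis. (u \<bullet> b) *\<^sub>R b)"
    by (simp add: euclidean_representation)
  also have "\<dots> = (\<Sum>b\<in>Basis. (u \<bullet> b) *\<^sub>R F b)"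
    using assms by (simp add: linear_sum linear_scale)
  also have "norm \<dots> \<le> (\<Sum>b\<in>Basis. norm (F b) * norm u)"
    by (rule order_trans[OF norm_sum])
      (auto intro!: sum_mono mult_left_mono simp: mult.commute[of "\<bar>_\<bar>"] Basis_le_norm)
  finally show ?thesis by (simp add: sum_distrib_right)
qed

lemma smooth_on_differentiable: "smooth_on S F \<Longrightarrow> z \<in> S \<Longrightarrow> F differentiable at z"
  unfolding smooth_on_def by (metis Ck_on.simps(2))

lemma smooth_on_continuous: "smooth_on S F \<Longrightarrow> continuous_on S F"
  unfolding smooth_on_def by (metis Ck_on.simps(1))

lemma smooth_on_frechet_derivative:
  "smooth_on S F \<Longrightarrow> smooth_on S (\<lambda>z. frechet_derivative F (at z) u)"
  unfolding smooth_on_def by (metis Ck_on.simps(2))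

lemma smooth_on_has_derivative:
  "smooth_on S F \<Longrightarrow> z \<in> S \<Longrightarrow> (F has_derivative frechet_derivative F (at z)) (at z)"
  by (simp add: smooth_on_differentiable frechet_derivative_works[symmetric])

text \<open>A single constant for the size and the Lipschitz bound: summing such constants over the
  basis then serves every estimate for the metric and its derivatives.\<close>

definition lipschitz_bounded_on :: "'a::metric_space set \<Rightarrow> real \<Rightarrow> ('a \<Rightarrow> real) \<Rightarrow> bool" where
  "lipschitz_bounded_on S K F \<longleftrightarrow>
     (\<forall>z\<in>S. \<bar>F z\<bar> \<le> K) \<and> (\<forall>z\<in>S. \<forall>z'\<in>S. \<bar>F z - F z'\<bar> \<le> K * dist z z')"

text \<open>Compactness of the ball bounds \<open>F\<close> and its partial derivatives. The latter
  bound the operator norm of the derivative, and on the convex ball the mean value inequality turns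
  this into a Lipschitz constant.\<close>

lemma smooth_on_lipschitz_bounded:
  fixes F :: "'a::euclidean_space \<Rightarrow> real"
  assumes F: "smooth_on S F" and sub: "cball a r \<subseteq> S"
  shows "\<exists>K. lipschitz_bounded_on (cball a r) K F"
proof -
  have bdd: "\<exists>K. \<forall>z\<in>cball a r. \<bar>G z\<bar> \<le> K" if "smooth_on S G" for G :: "'a \<Rightarrow> real"
  proof -
    have "continuous_on (cball a r) G"
      using smooth_on_continuous[OF that] sub continuous_on_subset by blast
    then have "bounded (G ` cball a r)"
      by (intro compact_imp_bounded compact_continuous_image) auto
    then show ?thesis unfolding bounded_iff by auto
  qed
  obtain K0 where K0: "\<And>z. z \<in> cball a r \<Longrightarrow> \<bar>F z\<bar> \<le> K0" using bdd[OF F] by blast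
  have "\<exists>K. \<forall>b. \<forall>z\<in>cball a r. \<bar>frechet_derivative F (at z) b\<bar> \<le> K b"
    using bdd[OF smooth_on_frechet_derivative[OF F]] by metis
  then obtain K where K: "\<And>b z. z \<in> cball a r \<Longrightarrow> \<bar>frechet_derivative F (at z) b\<bar> \<le> K b"
    by blast
  define K1 where "K1 = (\<Sum>b\<in>Basis. K b)"
  have "\<bar>F z - F z'\<bar> \<le> K1 * dist z z'" if "z \<in> cball a r" "z' \<in> cball a r" for z z'
  proof -
    have "norm (F z - F z') \<le> K1 * norm (z - z')"
    proof (rule differentiable_bound[OF convex_cball[of a r]])
      fix y assume y: "y \<in> cball a r"
      show "(F has_derivative frechet_derivative F (at y)) (at y within cball a r)"
        using smooth_on_has_derivative[OF F] sub y by (blast intro: has_derivative_at_withinI)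
      have "linear (frechet_derivative F (at y))"
        using smooth_on_has_derivative[OF F] sub y
        by (blast intro: has_derivative_linear)
      then have "norm (frechet_derivative F (at y) u) \<le> K1 * norm u" for u
        unfolding K1_def
        by (rule order_trans[OF norm_le_sum_Basis])
          (auto intro!: mult_right_mono sum_mono simp: K[OF y])
      then show "onorm (frechet_derivative F (at y)) \<le> K1"
        by (rule onorm_le)
    qed (use that in auto)
    then show ?thesis by (simp add: dist_norm)
  qed
  then have "lipschitz_bounded_on (cball a r) (max K0 K1) F"
    using K0 unfolding lipschitz_bounded_on_def
    by (fastforce intro: le_max_iff_disj[THEN iffD2] order_trans[OF _ mult_right_mono[OF max.cobounded2 zero_le_dist]])
  then show ?thesis by blast
qed

lemma bilinear_abs_le_sum_Basis:
  fixes B :: "'a::euclidean_space \<Rightarrow> 'a \<Rightarrow> real"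
  assumes B: "bilinear B"
  shows "\<bar>B u w\<bar> \<le> (\<Sum>b\<in>Basis. \<Sum>b'\<in>Basis. \<bar>B b b'\<bar>) * norm u * norm w"
proof -
  have "linear (\<lambda>u. B u w)" using B unfolding bilinear_def by blast
  then have "norm (B u w) \<le> (\<Sum>b\<in>Basis. norm (B b w)) * norm u"
    by (rule norm_le_sum_Basis)
  also have "\<dots> \<le> (\<Sum>b\<in>Basis. (\<Sum>b'\<in>Basis. norm (B b b')) * norm w) * norm u"
    using B unfolding bilinear_def
    by (intro mult_right_mono sum_mono norm_le_sum_Basis) auto
  finally show ?thesis by (simp add: mult_ac flip: sum_distrib_left)
qed

lemma bilinear_diff:
  fixes B C :: "'a::real_vector \<Rightarrow> 'b::real_vector \<Rightarrow> 'c::real_vector"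
  assumes "bilinear B" "bilinear C"
  shows "bilinear (\<lambda>u w. B u w - C u w)"
  using assms unfolding bilinear_def by (auto intro: linear_compose_sub)

section \<open>Charts, transition maps and tangent maps\<close>

locale riemannian =
  fixes M :: "('m::{t2_space, second_countable_topology}, 'e::euclidean_space) riem"
  assumes riemannian_manifold: "riemannian_manifold M"
begin

text \<open>Converts the components of a tangent vector from the chart around \<open>p\<close> to
  the one around \<open>q\<close>. When \<open>q\<close> is the base point itself, the result is in
  the representation that \<open>metric\<close> expects.\<close>

definition tangent_map :: "'m \<Rightarrow> 'm \<Rightarrow> 'e \<Rightarrow> 'e \<Rightarrow> 'e" where
  "tangent_map p q z = frechet_derivative (transition M p q) (at z)"

lemma smooth: "smooth_manifold M"
  using riemannian_manifold unfolding riemannian_manifold_def by blast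

lemma in_chart_dom [simp]: "p \<in> chart_dom M p"
  and open_chart_dom: "open (chart_dom M p)"
  and open_chart_image: "open (chart M p ` chart_dom M p)"
  and chart_homeomorphism: "homeomorphism (chart_dom M p) (chart M p ` chart_dom M p) (chart M p) (chart_inv M p)"
  and smooth_transition: "smooth_on (chart M p ` (chart_dom M p \<inter> chart_dom M q)) (transition M p q)"
  using smooth unfolding smooth_manifold_def by blast+

lemma chart_inv_chart [simp]: "x \<in> chart_dom M p \<Longrightarrow> chart_inv M p (chart M p x) = x"
  using chart_homeomorphism by (rule homeomorphism_apply1)

lemma chart_chart_inv [simp]: "z \<in> chart M p ` chart_dom M p \<Longrightarrow> chart M p (chart_inv M p z) = z"
  using chart_homeomorphism by (rule homeomorphism_apply2)

lemma chart_inv_in_dom: "z \<in> chart M p ` chart_dom M p \<Longrightarrow> chart_inv M p z \<in> chart_dom M p"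
  by auto

lemma continuous_on_chart: "continuous_on (chart_dom M p) (chart M p)"
  using chart_homeomorphism by (rule homeomorphism_cont1)

lemma continuous_on_chart_inv: "continuous_on (chart M p ` chart_dom M p) (chart_inv M p)"
  using chart_homeomorphism by (rule homeomorphism_cont2)

lemma isCont_chart: "x \<in> chart_dom M p \<Longrightarrow> isCont (chart M p) x"
  using continuous_on_chart open_chart_dom continuous_on_eq_continuous_at by blast

lemma open_chart_image_subset:
  assumes "open W" "W \<subseteq> chart_dom M p"
  shows "open (chart M p ` W)"
proof -
  have "openin (top_of_set (chart_dom M p)) W"
    using assms by (simp add: open_subset)
  then have "openin (top_of_set (chart M p ` chart_dom M p)) (chart M p ` W)"
    using homeomorphism_imp_open_map[OF chart_homeomorphism] by blast
  then show ?thesis using open_chart_image openin_open_trans by blast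
qed

lemma open_chart_inv_image:
  assumes "open V" "V \<subseteq> chart M p ` chart_dom M p"
  shows "open (chart_inv M p ` V)"
proof -
  have "openin (top_of_set (chart M p ` chart_dom M p)) V"
    using assms by (simp add: open_subset)
  then have "openin (top_of_set (chart_dom M p)) (chart_inv M p ` V)"
    using homeomorphism_imp_open_map[OF homeomorphism_symD[OF chart_homeomorphism]] by blast
  then show ?thesis using open_chart_dom openin_open_trans by blast
qed

lemma transition_chart: "x \<in> chart_dom M p \<Longrightarrow> transition M p q (chart M p x) = chart M q x"
  by (simp add: transition_def)

lemma transition_has_derivative:
  assumes "x \<in> chart_dom M p" "x \<in> chart_dom M q"
  shows "(transition M p q has_derivative tangent_map p q (chart M p x)) (at (chart M p x))"
  unfolding tangent_map_def
  using assms by (intro smooth_on_has_derivative[OF smooth_transition]) auto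

lemma linear_tangent_map:
  assumes "x \<in> chart_dom M p" "x \<in> chart_dom M q"
  shows "linear (tangent_map p q (chart M p x))"
  using transition_has_derivative[OF assms] has_derivative_linear by blast

text \<open>The two transition maps are mutually inverse on an open set, so by the chain rule their
  derivatives compose to the identity.\<close>

lemma tangent_map_inverse:
  assumes x: "x \<in> chart_dom M p" "x \<in> chart_dom M q"
  shows "tangent_map q p (chart M q x) (tangent_map p q (chart M p x) u) = u"
proof -
  let ?S = "chart M p ` (chart_dom M p \<inter> chart_dom M q)"
  have S: "open ?S" "chart M p x \<in> ?S"
    using x open_chart_dom by (auto intro!: open_chart_image_subset)
  have "(transition M q p \<circ> transition M p q has_derivative
      tangent_map q p (chart M q x) \<circ> tangent_map p q (chart M p x)) (at (chart M p x))"
    by (rule diff_chain_at[OF transition_has_derivative[OF x]])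
      (simp add: transition_chart[OF x(1)] transition_has_derivative[OF x(2,1)])
  moreover have "(transition M q p \<circ> transition M p q has_derivative id) (at (chart M p x))"
  proof (rule has_derivative_transform_within_open[OF has_derivative_id S])
    fix z assume "z \<in> ?S"
    then show "id z = (transition M q p \<circ> transition M p q) z"
      by (auto simp: transition_chart)
  qed
  ultimately have "tangent_map q p (chart M q x) \<circ> tangent_map p q (chart M p x) = id"
    by (rule has_derivative_unique)
  then show ?thesis by (metis comp_apply id_apply)
qed

lemma bilinear_metric: "bilinear (metric M p)"
  and metric_sym: "metric M p u w = metric M p w u"
  and metric_pos: "u \<noteq> 0 \<Longrightarrow> metric M p u u > 0"
  and smooth_coord_metric: "smooth_on (chart M p ` chart_dom M p) (\<lambda>z. coord_metric M p z u w)"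
  using riemannian_manifold unfolding riemannian_manifold_def by blast+

lemma metric_nonneg: "metric M p u u \<ge> 0"
  by (cases "u = 0") (auto simp: bilinear_lzero[OF bilinear_metric] less_imp_le metric_pos)

lemma tnorm_nonneg: "tnorm M p u \<ge> 0"
  by (simp add: tnorm_def metric_nonneg)

lemma tnorm_power2: "(tnorm M p u)\<^sup>2 = metric M p u u"
  by (simp add: tnorm_def metric_nonneg)

lemma coord_metric_chart:
  "x \<in> chart_dom M p \<Longrightarrow> coord_metric M p (chart M p x) u w =
     metric M x (tangent_map p x (chart M p x) u) (tangent_map p x (chart M p x) w)"
  by (simp add: coord_metric_def Let_def tangent_map_def)

lemma bilinear_coord_metric:
  assumes "z \<in> chart M p ` chart_dom M p"
  shows "bilinear (coord_metric M p z)"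
proof -
  obtain x where x: "x \<in> chart_dom M p" "z = chart M p x" using assms by blast
  have T: "linear (tangent_map p x z)" using linear_tangent_map[OF x(1) in_chart_dom] x by simp
  have *: "coord_metric M p z = (\<lambda>u w. metric M x (tangent_map p x z u) (tangent_map p x z w))"
    using coord_metric_chart[OF x(1)] x(2) by blast
  show ?thesis
    unfolding * bilinear_def
    using bilinear_metric[of x] unfolding bilinear_def
    by (auto intro: linear_compose[OF T, unfolded o_def])
qed

lemma coord_metric_sym:
  "z \<in> chart M p ` chart_dom M p \<Longrightarrow> coord_metric M p z u w = coord_metric M p z w u"
  using coord_metric_chart metric_sym by auto

lemma coord_metric_pos:
  assumes "z \<in> chart M p ` chart_dom M p" "u \<noteq> 0"
  shows "coord_metric M p z u u > 0"
proof -
  obtain x where x: "x \<in> chart_dom M p" "z = chart M p x" using assms by blast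
  have "tangent_map x p (chart M x x) (tangent_map p x z u) = u"
    using tangent_map_inverse[OF x(1) in_chart_dom, of u] x by simp
  then have "tangent_map p x z u \<noteq> 0"
    using assms(2) linear_0[OF linear_tangent_map[OF in_chart_dom x(1)]] by auto
  then show ?thesis using x coord_metric_chart metric_pos by simp
qed

text \<open>The first vector \<open>u\<close> is the direction of differentiation, \<open>v\<close>
  and \<open>w\<close> fill the slots of the metric.\<close>

definition dmetric :: "'m \<Rightarrow> 'e \<Rightarrow> 'e \<Rightarrow> 'e \<Rightarrow> 'e \<Rightarrow> real" where
  "dmetric p z u v w = frechet_derivative (\<lambda>y. coord_metric M p y v w) (at z) u"

lemma christoffel_dmetric:
  "christoffel M p z u v w = (dmetric p z u v w + dmetric p z v u w - dmetric p z w u v) / 2"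
  by (simp add: christoffel_def dmetric_def)

lemma coord_metric_has_derivative:
  "z \<in> chart M p ` chart_dom M p \<Longrightarrow>
     ((\<lambda>y. coord_metric M p y v w) has_derivative (\<lambda>u. dmetric p z u v w)) (at z)"
  unfolding dmetric_def using smooth_on_has_derivative[OF smooth_coord_metric] by blast

lemma linear_dmetric: "z \<in> chart M p ` chart_dom M p \<Longrightarrow> linear (\<lambda>u. dmetric p z u v w)"
  using coord_metric_has_derivative has_derivative_linear by blast

lemma bilinear_dmetric:
  assumes z: "z \<in> chart M p ` chart_dom M p"
  shows "bilinear (dmetric p z u)"
proof -
  let ?I = "chart M p ` chart_dom M p"
  note [derivative_intros] = coord_metric_has_derivative[OF z]
  \<comment> \<open>The coordinate metric is bilinear only over the chart image. This set is open,
    so a function agreeing with a coefficient there has the same derivative at \<open>z\<close>, and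
    each linearity law follows by differentiating its right-hand side.\<close>
  have tr: "dmetric p z u v w = G' u"
    if "(G has_derivative G') (at z)" "\<And>y. y \<in> ?I \<Longrightarrow> G y = coord_metric M p y v w" for G G' v w
  proof -
    have "((\<lambda>y. coord_metric M p y v w) has_derivative G') (at z)"
      by (rule has_derivative_transform_within_open[OF that(1) open_chart_image z that(2)])
    then have "(\<lambda>u. dmetric p z u v w) = G'"
      by (rule has_derivative_unique[OF coord_metric_has_derivative[OF z]])
    then show ?thesis by (rule fun_cong)
  qed
  note bl = bilinear_coord_metric
  have "linear (dmetric p z u v)" for v
  proof (rule linearI)
    fix b c r
    show "dmetric p z u v (b + c) = dmetric p z u v b + dmetric p z u v c"
      by (rule tr, (rule derivative_intros)+) (simp add: bilinear_radd[OF bl])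
    show "dmetric p z u v (r *\<^sub>R b) = r *\<^sub>R dmetric p z u v b"
      by (rule tr, (rule derivative_intros)+) (simp add: bilinear_rmul[OF bl])
  qed
  moreover have "linear (\<lambda>v. dmetric p z u v w)" for w
  proof (rule linearI)
    fix b c r
    show "dmetric p z u (b + c) w = dmetric p z u b w + dmetric p z u c w"
      by (rule tr, (rule derivative_intros)+) (simp add: bilinear_ladd[OF bl])
    show "dmetric p z u (r *\<^sub>R b) w = r *\<^sub>R dmetric p z u b w"
      by (rule tr, (rule derivative_intros)+) (simp add: bilinear_lmul[OF bl])
  qed
  ultimately show ?thesis unfolding bilinear_def by blast
qed

end

lemma trilinear_abs_le_sum_Basis:
  fixes T :: "'a::euclidean_space \<Rightarrow> 'a \<Rightarrow> 'a \<Rightarrow> real"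
  assumes T: "\<And>v w. linear (\<lambda>u. T u v w)" "\<And>u. bilinear (T u)"
  shows "\<bar>T u v w\<bar> \<le> (\<Sum>a\<in>Basis. \<Sum>b\<in>Basis. \<Sum>c\<in>Basis. \<bar>T a b c\<bar>) * norm u * norm v * norm w"
proof -
  have "norm (T u v w) \<le> (\<Sum>a\<in>Basis. norm (T a v w)) * norm u"
    by (rule norm_le_sum_Basis[OF T(1)])
  also have "\<dots> \<le> (\<Sum>a\<in>Basis. (\<Sum>b\<in>Basis. \<Sum>c\<in>Basis. \<bar>T a b c\<bar>) * norm v * norm w) * norm u"
    unfolding real_norm_def
    by (intro mult_right_mono sum_mono bilinear_abs_le_sum_Basis T(2)) simp
  finally show ?thesis by (simp add: sum_distrib_right[symmetric] mult.assoc mult.commute[of "norm u"])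
qed

text \<open>The metric is smooth in the base point for fixed vectors. The expansion separates base
  point and vectors, which yields joint continuity and a product rule when all of them move.\<close>

lemma bilinear_Basis_expansion:
  fixes B :: "'a::euclidean_space \<Rightarrow> 'a \<Rightarrow> real"
  assumes B: "bilinear B"
  shows "B u w = (\<Sum>b\<in>Basis. \<Sum>b'\<in>Basis. (u \<bullet> b) * (w \<bullet> b') * B b b')"
proof -
  have "B u w = B (\<Sum>b\<in>Basis. (u \<bullet> b) *\<^sub>R b) (\<Sum>b\<in>Basis. (w \<bullet> b) *\<^sub>R b)"
    by (simp add: euclidean_representation)
  then show ?thesis
    by (simp add: bilinear_sum[OF B] sum.cartesian_product bilinear_lmul[OF B] bilinear_rmul[OF B] mult_ac split_def)
qed

lemma abs_half_sum_le:
  fixes x y z E :: real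
  assumes "\<bar>x\<bar> \<le> E" "\<bar>y\<bar> \<le> E" "\<bar>z\<bar> \<le> E"
  shows "\<bar>(x + y - z) / 2\<bar> \<le> 3 / 2 * E"
  using assms by (auto simp: abs_le_iff field_simps)

lemma has_real_derivative_inner_const:
  "(f has_vector_derivative f') (at t within J) \<Longrightarrow>
     ((\<lambda>s. f s \<bullet> b) has_real_derivative (f' \<bullet> b)) (at t within J)"
  unfolding has_real_derivative_iff_has_vector_derivative
  by (rule bounded_linear.has_vector_derivative[OF bounded_linear_inner_left])

lemma has_vector_derivative_imp_continuous:
  "(f has_vector_derivative f') (at t within J) \<Longrightarrow> continuous (at t within J) f"
  unfolding has_vector_derivative_def by (rule has_derivative_continuous)

lemma eventually_within_subset_interval:
  fixes t :: real
  assumes "\<forall>\<^sub>F s in at t within {0..1}. P s" "P t" "0 \<le> t" "t < 1"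
  obtains \<delta> where "\<delta> > 0" "t + \<delta> \<le> 1" "\<And>s. s \<in> {t..t + \<delta>} \<Longrightarrow> P s"
proof -
  obtain d where d: "d > 0" "\<And>s. s \<in> {0..1} \<Longrightarrow> s \<noteq> t \<Longrightarrow> dist s t < d \<Longrightarrow> P s"
    using assms(1) unfolding eventually_at by auto
  show thesis
  proof (rule that[of "min (d / 2) (1 - t)"])
    fix s assume "s \<in> {t..t + min (d / 2) (1 - t)}"
    then show "P s" using d assms(2-4) by (cases "s = t") (auto simp: dist_real_def)
  qed (use d assms in auto)
qed

section \<open>Uniform bounds for the metric near a point\<close>

context riemannian
begin

text \<open>Collects the local estimates under an ellipticity constant \<open>m\<close> and one
  upper constant \<open>K\<close>. The bounds at a single point control lengths, speeds and
  accelerations; the Lipschitz bounds in \<open>z\<close> are for uniqueness of geodesics.\<close>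

definition metric_bounds :: "'m \<Rightarrow> 'e set \<Rightarrow> real \<Rightarrow> real \<Rightarrow> bool" where
  "metric_bounds p S m K \<longleftrightarrow> 0 < m \<and> 0 < K \<and> S \<subseteq> chart M p ` chart_dom M p \<and>
    (\<forall>z\<in>S. \<forall>u. m * (norm u)\<^sup>2 \<le> coord_metric M p z u u) \<and>
    (\<forall>z\<in>S. \<forall>u w. \<bar>coord_metric M p z u w\<bar> \<le> K * norm u * norm w) \<and>
    (\<forall>z\<in>S. \<forall>z'\<in>S. \<forall>u w. \<bar>coord_metric M p z u w - coord_metric M p z' u w\<bar>
        \<le> K * dist z z' * norm u * norm w) \<and>
    (\<forall>z\<in>S. \<forall>u v w. \<bar>christoffel M p z u v w\<bar> \<le> K * norm u * norm v * norm w) \<and>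
    (\<forall>z\<in>S. \<forall>z'\<in>S. \<forall>u v w. \<bar>christoffel M p z u v w - christoffel M p z' u v w\<bar>
        \<le> K * dist z z' * norm u * norm v * norm w)"

lemma metric_boundsD:
  assumes "metric_bounds p S m K"
  shows "0 < m" "0 < K" "S \<subseteq> chart M p ` chart_dom M p"
    "z \<in> S \<Longrightarrow> m * (norm u)\<^sup>2 \<le> coord_metric M p z u u"
    "z \<in> S \<Longrightarrow> \<bar>coord_metric M p z u w\<bar> \<le> K * norm u * norm w"
    "z \<in> S \<Longrightarrow> z' \<in> S \<Longrightarrow> \<bar>coord_metric M p z u w - coord_metric M p z' u w\<bar>
        \<le> K * dist z z' * norm u * norm w"
    "z \<in> S \<Longrightarrow> \<bar>christoffel M p z u v w\<bar> \<le> K * norm u * norm v * norm w"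
    "z \<in> S \<Longrightarrow> z' \<in> S \<Longrightarrow> \<bar>christoffel M p z u v w - christoffel M p z' u v w\<bar>
        \<le> K * dist z z' * norm u * norm v * norm w"
  using assms unfolding metric_bounds_def by blast+

text \<open>On the compact product of the ball and the unit sphere the quadratic form attains its
  minimum, which is positive by definiteness; homogeneity extends the bound to all
  \<open>u\<close>.\<close>

lemma coord_metric_lower_bound:
  assumes sub: "cball a r \<subseteq> chart M p ` chart_dom M p" and "0 \<le> r"
  shows "\<exists>m>0. \<forall>z\<in>cball a r. \<forall>u. m * (norm u)\<^sup>2 \<le> coord_metric M p z u u"
proof -
  let ?C = "cball a r \<times> sphere (0::'e) 1"
  have cont: "continuous_on ?C (\<lambda>x. coord_metric M p (fst x) (snd x) (snd x))"
  proof (subst continuous_on_cong[OF refl])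
    fix x assume "x \<in> ?C"
    then show "coord_metric M p (fst x) (snd x) (snd x) =
        (\<Sum>b\<in>Basis. \<Sum>b'\<in>Basis. (snd x \<bullet> b) * (snd x \<bullet> b') * coord_metric M p (fst x) b b')"
      using sub by (intro bilinear_Basis_expansion bilinear_coord_metric) auto
  next
    have "continuous_on ?C (\<lambda>x. coord_metric M p (fst x) b b')" for b b'
      using sub by (intro continuous_on_compose2[OF smooth_on_continuous[OF smooth_coord_metric]]
          continuous_intros) auto
    then show "continuous_on ?C (\<lambda>x. \<Sum>b\<in>Basis. \<Sum>b'\<in>Basis.
        (snd x \<bullet> b) * (snd x \<bullet> b') * coord_metric M p (fst x) b b')"
      by (intro continuous_intros)
  qed
  obtain e :: 'e where "e \<in> Basis" using nonempty_Basis by blast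
  then have "(a, e) \<in> ?C" using \<open>0 \<le> r\<close> by simp
  moreover have "compact ?C" by (intro compact_Times compact_cball compact_sphere)
  ultimately obtain x0 where x0: "x0 \<in> ?C"
    "\<And>x. x \<in> ?C \<Longrightarrow> coord_metric M p (fst x0) (snd x0) (snd x0) \<le> coord_metric M p (fst x) (snd x) (snd x)"
    using continuous_attains_inf[OF _ _ cont] by blast
  define m where "m = coord_metric M p (fst x0) (snd x0) (snd x0)"
  have "m > 0"
    unfolding m_def using x0(1) sub by (intro coord_metric_pos) auto
  moreover have "m * (norm u)\<^sup>2 \<le> coord_metric M p z u u" if z: "z \<in> cball a r" for z u
  proof (cases "u = 0")
    case True
    then show ?thesis using bilinear_lzero[OF bilinear_coord_metric] z sub by auto
  next
    case False
    have bl: "bilinear (coord_metric M p z)" using z sub by (intro bilinear_coord_metric) auto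
    let ?e = "u /\<^sub>R norm u"
    have "m \<le> coord_metric M p z ?e ?e"
      unfolding m_def using x0(2)[of "(z, ?e)"] z False by auto
    then have "m * (norm u)\<^sup>2 \<le> coord_metric M p z ?e ?e * (norm u)\<^sup>2"
      by (rule mult_right_mono) simp
    then show ?thesis
      using False by (simp add: bilinear_lmul[OF bl] bilinear_rmul[OF bl] power2_eq_square field_simps)
  qed
  ultimately show ?thesis by blast
qed

text \<open>Each of the finitely many coefficients on basis vectors is bounded and Lipschitz on the
  ball; multilinearity carries the summed constants over to arbitrary vectors.\<close>

lemma metric_bounds_exist:
  assumes sub: "cball a r \<subseteq> chart M p ` chart_dom M p" and "0 \<le> r"
  shows "\<exists>m K. metric_bounds p (cball a r) m K"
proof -
  let ?g = "coord_metric M p" and ?d = "dmetric p" and ?S = "cball a r"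
  obtain m where m: "m > 0" "\<And>z u. z \<in> ?S \<Longrightarrow> m * (norm u)\<^sup>2 \<le> ?g z u u"
    using coord_metric_lower_bound[OF assms] by blast
  have "\<forall>b c. \<exists>K. lipschitz_bounded_on ?S K (\<lambda>z. ?g z b c)"
    using smooth_on_lipschitz_bounded[OF smooth_coord_metric sub] by blast
  then obtain Kg where Kg: "\<And>b c. lipschitz_bounded_on ?S (Kg b c) (\<lambda>z. ?g z b c)" by metis
  have "\<forall>a b c. \<exists>K. lipschitz_bounded_on ?S K (\<lambda>z. ?d z a b c)"
    using smooth_on_lipschitz_bounded[OF smooth_on_frechet_derivative[OF smooth_coord_metric] sub]
    unfolding dmetric_def by blast
  then obtain Kd where Kd: "\<And>a b c. lipschitz_bounded_on ?S (Kd a b c) (\<lambda>z. ?d z a b c)" by metis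
  define G where "G = (\<Sum>b\<in>Basis. \<Sum>c\<in>Basis. Kg b c)"
  define D where "D = (\<Sum>a\<in>Basis. \<Sum>b\<in>Basis. \<Sum>c\<in>Basis. Kd a b c)"
  \<comment> \<open>A Christoffel symbol is half of a signed sum of three derivatives, each
    controlled by \<open>D\<close>, hence \<open>3 / 2 * D\<close>; the summand 1 makes
    \<open>K\<close> positive.\<close>
  define K where "K = \<bar>G\<bar> + 2 * \<bar>D\<bar> + 1"
  have K: "K > 0" "G \<le> K" "3 / 2 * D \<le> K" unfolding K_def by linarith+
  have bg: "bilinear (?g z)" if "z \<in> ?S" for z using that sub by (intro bilinear_coord_metric) auto
  have ld: "linear (\<lambda>u. ?d z u v w)" and bd: "bilinear (?d z u)" if "z \<in> ?S" for z u v w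
    using that sub by (auto intro!: linear_dmetric bilinear_dmetric)
  have g0: "\<bar>?g z u w\<bar> \<le> K * norm u * norm w" if z: "z \<in> ?S" for z u w
  proof -
    have "\<bar>?g z u w\<bar> \<le> (\<Sum>b\<in>Basis. \<Sum>c\<in>Basis. \<bar>?g z b c\<bar>) * norm u * norm w"
      by (rule bilinear_abs_le_sum_Basis[OF bg[OF z]])
    also have "\<dots> \<le> G * norm u * norm w"
      unfolding G_def using Kg z unfolding lipschitz_bounded_on_def
      by (intro mult_right_mono sum_mono) auto
    also have "\<dots> \<le> K * norm u * norm w" by (intro mult_right_mono K) auto
    finally show ?thesis .
  qed
  have g1: "\<bar>?g z u w - ?g z' u w\<bar> \<le> K * dist z z' * norm u * norm w"
    if z: "z \<in> ?S" "z' \<in> ?S" for z z' u w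
  proof -
    have "\<bar>?g z u w - ?g z' u w\<bar> \<le> (\<Sum>b\<in>Basis. \<Sum>c\<in>Basis. \<bar>?g z b c - ?g z' b c\<bar>) * norm u * norm w"
      by (rule bilinear_abs_le_sum_Basis[OF bilinear_diff[OF bg[OF z(1)] bg[OF z(2)]]])
    also have "\<dots> \<le> (\<Sum>b\<in>Basis. \<Sum>c\<in>Basis. Kg b c * dist z z') * norm u * norm w"
      using Kg z unfolding lipschitz_bounded_on_def
      by (intro mult_right_mono sum_mono) auto
    also have "\<dots> = G * dist z z' * norm u * norm w" by (simp add: G_def sum_distrib_right)
    also have "\<dots> \<le> K * dist z z' * norm u * norm w" by (intro mult_right_mono K) auto
    finally show ?thesis .
  qed
  have d0: "\<bar>?d z u v w\<bar> \<le> D * norm u * norm v * norm w" if z: "z \<in> ?S" for z u v w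
  proof -
    have "\<bar>?d z u v w\<bar> \<le> (\<Sum>a\<in>Basis. \<Sum>b\<in>Basis. \<Sum>c\<in>Basis. \<bar>?d z a b c\<bar>) * norm u * norm v * norm w"
      by (rule trilinear_abs_le_sum_Basis[OF ld[OF z] bd[OF z]])
    also have "\<dots> \<le> D * norm u * norm v * norm w"
      unfolding D_def using Kd z unfolding lipschitz_bounded_on_def
      by (intro mult_right_mono sum_mono) auto
    finally show ?thesis .
  qed
  have d1: "\<bar>?d z u v w - ?d z' u v w\<bar> \<le> D * dist z z' * norm u * norm v * norm w"
    if z: "z \<in> ?S" "z' \<in> ?S" for z z' u v w
  proof -
    have "\<bar>?d z u v w - ?d z' u v w\<bar> \<le> (\<Sum>a\<in>Basis. \<Sum>b\<in>Basis. \<Sum>c\<in>Basis. \<bar>?d z a b c - ?d z' a b c\<bar>)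
        * norm u * norm v * norm w"
      by (rule trilinear_abs_le_sum_Basis)
        (intro linear_compose_sub bilinear_diff ld bd z)+
    also have "\<dots> \<le> (\<Sum>a\<in>Basis. \<Sum>b\<in>Basis. \<Sum>c\<in>Basis. Kd a b c * dist z z') * norm u * norm v * norm w"
      using Kd z unfolding lipschitz_bounded_on_def
      by (intro mult_right_mono sum_mono) auto
    also have "\<dots> = D * dist z z' * norm u * norm v * norm w" by (simp add: D_def sum_distrib_right)
    finally show ?thesis .
  qed
  have c0: "\<bar>christoffel M p z u v w\<bar> \<le> K * norm u * norm v * norm w" if z: "z \<in> ?S" for z u v w
  proof -
    have "\<bar>christoffel M p z u v w\<bar> \<le> 3 / 2 * (D * norm u * norm v * norm w)"
    proof -
      have "\<bar>?d z v u w\<bar> \<le> D * norm u * norm v * norm w" "\<bar>?d z w u v\<bar> \<le> D * norm u * norm v * norm w"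
        using d0[OF z, of v u w] d0[OF z, of w u v] by (simp_all add: mult_ac)
      then show ?thesis
        using d0[OF z, of u v w] unfolding christoffel_dmetric by (intro abs_half_sum_le)
    qed
    also have "\<dots> = 3 / 2 * D * norm u * norm v * norm w" by simp
    also have "\<dots> \<le> K * norm u * norm v * norm w" by (intro mult_right_mono K) auto
    finally show ?thesis .
  qed
  have c1: "\<bar>christoffel M p z u v w - christoffel M p z' u v w\<bar> \<le> K * dist z z' * norm u * norm v * norm w"
    if z: "z \<in> ?S" "z' \<in> ?S" for z z' u v w
  proof -
    have "\<bar>christoffel M p z u v w - christoffel M p z' u v w\<bar> \<le> 3 / 2 * (D * dist z z' * norm u * norm v * norm w)"
    proof -
      have "\<bar>?d z v u w - ?d z' v u w\<bar> \<le> D * dist z z' * norm u * norm v * norm w"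
        "\<bar>?d z w u v - ?d z' w u v\<bar> \<le> D * dist z z' * norm u * norm v * norm w"
        using d1[OF z, of v u w] d1[OF z, of w u v] by (simp_all add: mult_ac)
      note abs_half_sum_le[OF d1[OF z, of u v w] this]
      moreover have "christoffel M p z u v w - christoffel M p z' u v w =
          ((?d z u v w - ?d z' u v w) + (?d z v u w - ?d z' v u w) - (?d z w u v - ?d z' w u v)) / 2"
        by (simp add: christoffel_dmetric field_simps)
      ultimately show ?thesis by (simp only:)
    qed
    also have "\<dots> = 3 / 2 * D * dist z z' * norm u * norm v * norm w" by simp
    also have "\<dots> \<le> K * dist z z' * norm u * norm v * norm w" by (intro mult_right_mono K) auto
    finally show ?thesis .
  qed
  have "metric_bounds p ?S m K"
    unfolding metric_bounds_def using m K(1) sub g0 g1 c0 c1 by blast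
  then show ?thesis by blast
qed

lemma metric_bounds_around:
  obtains r m K where "r > 0" "metric_bounds p (cball (chart M p p) r) m K"
proof -
  have "chart M p p \<in> chart M p ` chart_dom M p" by simp
  then obtain r where "r > 0" "cball (chart M p p) r \<subseteq> chart M p ` chart_dom M p"
    using open_chart_image open_contains_cball by blast
  then show thesis using metric_bounds_exist that by (metis less_imp_le)
qed

lemma christoffel_diff:
  assumes z: "z \<in> chart M p ` chart_dom M p"
  shows "christoffel M p z (u - u') v w = christoffel M p z u v w - christoffel M p z u' v w"
    and "christoffel M p z u (v - v') w = christoffel M p z u v w - christoffel M p z u v' w"
  by (simp_all add: christoffel_dmetric linear_diff[OF linear_dmetric[OF z]]
      bilinear_lsub[OF bilinear_dmetric[OF z]] bilinear_rsub[OF bilinear_dmetric[OF z]]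
      diff_divide_distrib add_divide_distrib)

text \<open>A product rule in three moving arguments, obtained by differentiating the basis
  expansion coefficient by coefficient.\<close>

lemma coord_metric_has_real_derivative:
  assumes z: "c t \<in> chart M p ` chart_dom M p" and t: "t \<in> J"
    and c: "(c has_vector_derivative c') (at t within J)"
    and a: "(a has_vector_derivative a') (at t within J)"
    and b: "(b has_vector_derivative b') (at t within J)"
  shows "((\<lambda>s. coord_metric M p (c s) (a s) (b s)) has_real_derivative
      dmetric p (c t) c' (a t) (b t) + coord_metric M p (c t) a' (b t) + coord_metric M p (c t) (a t) b')
      (at t within J)"
proof -
  let ?g = "coord_metric M p" and ?I = "chart M p ` chart_dom M p"
  have g: "((\<lambda>s. ?g (c s) i j) has_real_derivative dmetric p (c t) c' i j) (at t within J)" for i j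
    unfolding has_real_derivative_iff_has_vector_derivative
    using vector_derivative_diff_chain_within[OF c
        has_derivative_at_withinI[OF coord_metric_has_derivative[OF z]]]
    by (simp add: o_def)
  have "((\<lambda>s. \<Sum>i\<in>Basis. \<Sum>j\<in>Basis. (a s \<bullet> i) * (b s \<bullet> j) * ?g (c s) i j) has_real_derivative
      (\<Sum>i\<in>Basis. \<Sum>j\<in>Basis. ((a' \<bullet> i) * (b t \<bullet> j) + (b' \<bullet> j) * (a t \<bullet> i)) * ?g (c t) i j
         + dmetric p (c t) c' i j * ((a t \<bullet> i) * (b t \<bullet> j)))) (at t within J)"
    by (intro DERIV_sum DERIV_mult g has_real_derivative_inner_const a b)
  moreover have "(\<Sum>i\<in>Basis. \<Sum>j\<in>Basis. ((a' \<bullet> i) * (b t \<bullet> j) + (b' \<bullet> j) * (a t \<bullet> i)) * ?g (c t) i j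
         + dmetric p (c t) c' i j * ((a t \<bullet> i) * (b t \<bullet> j)))
      = dmetric p (c t) c' (a t) (b t) + ?g (c t) a' (b t) + ?g (c t) (a t) b'"
    unfolding bilinear_Basis_expansion[OF bilinear_coord_metric[OF z], of a']
      bilinear_Basis_expansion[OF bilinear_coord_metric[OF z], of "a t"]
      bilinear_Basis_expansion[OF bilinear_dmetric[OF z], of _ "a t"]
    by (simp add: sum.distrib[symmetric] algebra_simps)
  ultimately have der: "((\<lambda>s. \<Sum>i\<in>Basis. \<Sum>j\<in>Basis. (a s \<bullet> i) * (b s \<bullet> j) * ?g (c s) i j) has_real_derivative
      dmetric p (c t) c' (a t) (b t) + ?g (c t) a' (b t) + ?g (c t) (a t) b') (at t within J)"
    by simp
  \<comment> \<open>The expansion equals the metric only while \<open>c\<close> is in the chart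
    image; this image is open, so that holds near \<open>t\<close>.\<close>
  have ev: "\<forall>\<^sub>F s in at t within J. c s \<in> ?I"
    using has_vector_derivative_imp_continuous[OF c] open_chart_image z
    unfolding continuous_within by (metis topological_tendstoD)
  have eq: "(\<Sum>i\<in>Basis. \<Sum>j\<in>Basis. (a s \<bullet> i) * (b s \<bullet> j) * ?g (c s) i j) = ?g (c s) (a s) (b s)"
    if "c s \<in> ?I" for s
    using bilinear_Basis_expansion[OF bilinear_coord_metric[OF that]] by metis
  show ?thesis
    using der unfolding has_field_derivative_def
    by (rule has_derivative_transform_eventually)
      (use eventually_mono[OF ev eq] eq[OF z] t in simp_all)
qed

end

section \<open>The geodesic equation\<close>

text \<open>The factor \<open>exp (- C * t)\<close> makes \<open>E\<close> nonincreasing, so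
  \<open>E\<close> cannot rise above its initial value 0.\<close>

lemma gronwall_zero:
  fixes E :: "real \<Rightarrow> real"
  assumes "a \<le> b" and der: "\<And>t. t \<in> {a..b} \<Longrightarrow> (E has_real_derivative E' t) (at t within {a..b})"
    and le: "\<And>t. t \<in> {a..b} \<Longrightarrow> E' t \<le> C * E t"
    and "E a = 0" and nonneg: "\<And>t. t \<in> {a..b} \<Longrightarrow> 0 \<le> E t" and t: "t \<in> {a..b}"
  shows "E t = 0"
proof (cases "a < t")
  case False
  then show ?thesis using t \<open>E a = 0\<close> by auto
next
  case True
  let ?F = "\<lambda>t. E t * exp (- C * t)"
  have F: "(?F has_real_derivative (E' s - C * E s) * exp (- C * s)) (at s within {a..b})"
    if "s \<in> {a..b}" for s
    using that by (auto intro!: derivative_eq_intros der simp: algebra_simps)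
  have "?F t \<le> ?F a"
  proof (rule DERIV_nonpos_imp_decreasing_open[where f = ?F])
    show "a \<le> t" using True by simp
    show "continuous_on {a..t} ?F"
      using t by (intro continuous_on_subset[OF DERIV_continuous_on[OF F]]) auto
    fix s assume s: "a < s" "s < t"
    then have "s \<in> {a..b}" using t by auto
    then have "(?F has_real_derivative (E' s - C * E s) * exp (- C * s)) (at s)"
      using F[of s] s t at_within_Icc_at[of a s b] by auto
    moreover have "(E' s - C * E s) * exp (- C * s) \<le> 0"
      using le[OF \<open>s \<in> {a..b}\<close>] by (intro mult_nonpos_nonneg) auto
    ultimately show "\<exists>y. (?F has_real_derivative y) (at s) \<and> y \<le> 0" by blast
  qed
  then have "E t \<le> 0" using \<open>E a = 0\<close> by (simp add: mult_le_0_iff)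
  then show ?thesis using nonneg[OF t] by simp
qed

context riemannian
begin

text \<open>The acceleration \<open>a\<close> is characterised by its pairings with all
  \<open>w\<close>, as in \<open>geodesic_on\<close>; estimates for \<open>a\<close> come from a
  suitable choice of \<open>w\<close> and ellipticity.\<close>

definition geodesic_eq :: "'m \<Rightarrow> 'e \<Rightarrow> 'e \<Rightarrow> 'e \<Rightarrow> bool" where
  "geodesic_eq p z u a \<longleftrightarrow> (\<forall>w. coord_metric M p z a w + christoffel M p z u u w = 0)"

text \<open>Test the equation with \<open>w = a\<close>: ellipticity bounds the left side below by
  \<open>m * (norm a)\<^sup>2\<close>, and one factor \<open>norm a\<close> cancels.\<close>

lemma geodesic_eq_norm_le:
  assumes B: "metric_bounds p S m K" and z: "z \<in> S" and eq: "geodesic_eq p z u a"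
  shows "norm a \<le> K / m * (norm u)\<^sup>2"
proof (cases "a = 0")
  case True
  then show ?thesis using metric_boundsD(1,2)[OF B] by simp
next
  case False
  have "m * (norm a)\<^sup>2 \<le> coord_metric M p z a a" by (rule metric_boundsD(4)[OF B z])
  also have "\<dots> = - christoffel M p z u u a" using eq unfolding geodesic_eq_def by (metis add_eq_0_iff2)
  also have "\<dots> \<le> K * norm u * norm u * norm a"
    using metric_boundsD(7)[OF B z, of u u a] by linarith
  finally have "m * norm a * norm a \<le> K * (norm u)\<^sup>2 * norm a" by (simp add: power2_eq_square mult_ac)
  then have "m * norm a \<le> K * (norm u)\<^sup>2" using False by simp
  then show ?thesis using metric_boundsD(1)[OF B] by (simp add: field_simps)
qed

text \<open>Test the difference of the two equations with \<open>w = a1 - a2\<close>. The factor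
  collects the costs of moving the base point and the two velocity slots of the Christoffel symbol,
  and of moving the base point of the metric paired with \<open>a2\<close>, whose norm is bounded by
  the previous lemma.\<close>

lemma geodesic_eq_lipschitz:
  assumes B: "metric_bounds p S m K" and z: "z1 \<in> S" "z2 \<in> S"
    and eq: "geodesic_eq p z1 u1 a1" "geodesic_eq p z2 u2 a2"
    and V: "norm u1 \<le> V" "norm u2 \<le> V"
  shows "norm (a1 - a2) \<le> (K * V\<^sup>2 + 2 * K * V + K * (K / m * V\<^sup>2)) / m * (norm (z1 - z2) + norm (u1 - u2))"
proof (cases "a1 = a2")
  case True
  have "0 \<le> V" using V norm_ge_zero order_trans by blast
  then show ?thesis using metric_boundsD(1,2)[OF B] True by simp
next
  case False
  let ?g = "coord_metric M p" and ?G = "christoffel M p"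
  define w where "w = a1 - a2"
  define x where "x = norm (z1 - z2)"
  define y where "y = norm (u1 - u2)"
  have K: "0 < m" "0 < K" using metric_boundsD[OF B] by auto
  have V0: "0 \<le> V" using V norm_ge_zero order_trans by blast
  have zI: "z1 \<in> chart M p ` chart_dom M p" "z2 \<in> chart M p ` chart_dom M p"
    using z metric_boundsD(3)[OF B] by auto
  have a2: "norm a2 \<le> K / m * V\<^sup>2"
    using geodesic_eq_norm_le[OF B z(2) eq(2)] V(2) K
    by (meson divide_nonneg_pos less_imp_le mult_left_mono norm_ge_zero order_trans power_mono)
  have t1: "\<bar>?G z1 u1 u1 w - ?G z2 u1 u1 w\<bar> \<le> K * x * V\<^sup>2 * norm w"
  proof -
    have "\<bar>?G z1 u1 u1 w - ?G z2 u1 u1 w\<bar> \<le> K * x * norm u1 * norm u1 * norm w"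
      using metric_boundsD(8)[OF B z] by (simp add: x_def dist_norm)
    also have "\<dots> \<le> K * x * V * V * norm w"
      using K V V0 by (intro mult_mono mult_nonneg_nonneg) (auto simp: x_def)
    finally show ?thesis by (simp add: power2_eq_square mult_ac)
  qed
  have t2: "\<bar>?G z2 (u1 - u2) u1 w\<bar> \<le> K * y * V * norm w"
  proof -
    have "\<bar>?G z2 (u1 - u2) u1 w\<bar> \<le> K * y * norm u1 * norm w"
      using metric_boundsD(7)[OF B z(2)] by (simp add: y_def)
    also have "\<dots> \<le> K * y * V * norm w"
      using K V V0 by (intro mult_mono mult_nonneg_nonneg) (auto simp: y_def)
    finally show ?thesis .
  qed
  have t3: "\<bar>?G z2 u2 (u1 - u2) w\<bar> \<le> K * V * y * norm w"
  proof -
    have "\<bar>?G z2 u2 (u1 - u2) w\<bar> \<le> K * norm u2 * y * norm w"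
      using metric_boundsD(7)[OF B z(2)] by (simp add: y_def)
    also have "\<dots> \<le> K * V * y * norm w"
      using K V V0 by (intro mult_mono mult_nonneg_nonneg) (auto simp: y_def)
    finally show ?thesis .
  qed
  have t4: "\<bar>?g z1 a2 w - ?g z2 a2 w\<bar> \<le> K * x * (K / m * V\<^sup>2) * norm w"
  proof -
    have "\<bar>?g z1 a2 w - ?g z2 a2 w\<bar> \<le> K * x * norm a2 * norm w"
      using metric_boundsD(6)[OF B z] by (simp add: x_def dist_norm)
    also have "\<dots> \<le> K * x * (K / m * V\<^sup>2) * norm w"
      using K a2 by (intro mult_mono mult_nonneg_nonneg) (auto simp: x_def)
    finally show ?thesis .
  qed
  have "m * (norm w)\<^sup>2 \<le> ?g z1 w w" by (rule metric_boundsD(4)[OF B z(1)])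
  also have "\<dots> = ?g z1 a1 w - ?g z1 a2 w"
    using bilinear_lsub[OF bilinear_coord_metric[OF zI(1)], of a1 a2 w] by (simp add: w_def)
  \<comment> \<open>Telescoping: first the base point of the Christoffel term, then one velocity
    slot at a time, and finally the base point of the metric.\<close>
  also have "\<dots> = - (?G z1 u1 u1 w - ?G z2 u1 u1 w) - ?G z2 (u1 - u2) u1 w - ?G z2 u2 (u1 - u2) w
      - (?g z1 a2 w - ?g z2 a2 w)"
    using eq[unfolded geodesic_eq_def, rule_format, of w] christoffel_diff(1)[OF zI(2), of u1 u2 u1 w]
      christoffel_diff(2)[OF zI(2), of u2 u1 u2 w]
    by linarith
  also have "\<dots> \<le> K * x * V\<^sup>2 * norm w + K * y * V * norm w + K * V * y * norm w
      + K * x * (K / m * V\<^sup>2) * norm w"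
    using t1 t2 t3 t4 by linarith
  also have "\<dots> = ((K * V\<^sup>2 + K * (K / m * V\<^sup>2)) * x + (2 * K * V) * y) * norm w"
    by (simp add: algebra_simps)
  finally have "(m * norm w) * norm w \<le> ((K * V\<^sup>2 + K * (K / m * V\<^sup>2)) * x + (2 * K * V) * y) * norm w"
    by (simp add: power2_eq_square mult_ac)
  then have "m * norm w \<le> (K * V\<^sup>2 + K * (K / m * V\<^sup>2)) * x + (2 * K * V) * y"
    using False by (simp add: w_def)
  also have "\<dots> \<le> (K * V\<^sup>2 + 2 * K * V + K * (K / m * V\<^sup>2)) * (x + y)"
  proof -
    have "P * x + Q * y \<le> (P + Q) * (x + y)" if "0 \<le> P" "0 \<le> Q" for P Q
    proof -
      have "0 \<le> Q * x" "0 \<le> P * y" using that by (auto simp: x_def y_def)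
      then show ?thesis by (simp add: ring_distribs)
    qed
    from this[of "K * V\<^sup>2 + K * (K / m * V\<^sup>2)" "2 * K * V"] show ?thesis
      using K V0 by (simp add: add_ac)
  qed
  finally show ?thesis
    using K by (simp add: field_simps w_def x_def y_def)
qed

text \<open>The squared distance \<open>E\<close> in position and velocity satisfies
  \<open>E' \<le> C * E\<close>, because accelerations depend on both in a Lipschitz way; Gronwall
  then keeps it at 0.\<close>

lemma coordinate_geodesic_unique:
  assumes B: "metric_bounds p S m K" and "a \<le> b"
    and c: "\<And>t. t \<in> {a..b} \<Longrightarrow> c1 t \<in> S \<and> c2 t \<in> S"
    and u: "\<And>t. t \<in> {a..b} \<Longrightarrow> (c1 has_vector_derivative u1 t) (at t within {a..b})"
       "\<And>t. t \<in> {a..b} \<Longrightarrow> (c2 has_vector_derivative u2 t) (at t within {a..b})"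
    and a: "\<And>t. t \<in> {a..b} \<Longrightarrow> (u1 has_vector_derivative a1 t) (at t within {a..b})"
       "\<And>t. t \<in> {a..b} \<Longrightarrow> (u2 has_vector_derivative a2 t) (at t within {a..b})"
    and eq: "\<And>t. t \<in> {a..b} \<Longrightarrow> geodesic_eq p (c1 t) (u1 t) (a1 t)"
       "\<And>t. t \<in> {a..b} \<Longrightarrow> geodesic_eq p (c2 t) (u2 t) (a2 t)"
    and V: "\<And>t. t \<in> {a..b} \<Longrightarrow> norm (u1 t) \<le> V \<and> norm (u2 t) \<le> V"
    and init: "c1 a = c2 a" "u1 a = u2 a"
    and t: "t \<in> {a..b}"
  shows "c1 t = c2 t"
proof -
  define A where "A = (K * V\<^sup>2 + 2 * K * V + K * (K / m * V\<^sup>2)) / m"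
  define E where "E s = (c1 s - c2 s) \<bullet> (c1 s - c2 s) + (u1 s - u2 s) \<bullet> (u1 s - u2 s)" for s
  define E' where "E' s = 2 * ((c1 s - c2 s) \<bullet> (u1 s - u2 s)) + 2 * ((u1 s - u2 s) \<bullet> (a1 s - a2 s))" for s
  have "a \<in> {a..b}" using \<open>a \<le> b\<close> by simp
  then have V0: "0 \<le> V" using V norm_ge_zero order_trans by blast
  have A0: "0 \<le> A"
    unfolding A_def using metric_boundsD(1,2)[OF B] V0 by simp
  have "E t = 0"
  \<comment> \<open>With x and y the distances of positions and velocities, the mixed terms are (1 +
    A) times 2xy, at most (1 + A)(x^2 + y^2), and 2A y^2 remains; together this gives 1 +
    3A.\<close>
  proof (rule gronwall_zero[OF \<open>a \<le> b\<close>, where E = E and E' = E' and C = "1 + 3 * A"])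
    fix s assume s: "s \<in> {a..b}"
    note [derivative_intros] = u[OF s, unfolded has_vector_derivative_def]
      a[OF s, unfolded has_vector_derivative_def]
    show "(E has_real_derivative E' s) (at s within {a..b})"
      unfolding E_def E'_def has_field_derivative_def
      by (rule derivative_eq_intros refl ext | simp add: inner_commute algebra_simps)+
    let ?x = "norm (c1 s - c2 s)" and ?y = "norm (u1 s - u2 s)"
    have "(c1 s - c2 s) \<bullet> (u1 s - u2 s) \<le> ?x * ?y" by (rule norm_cauchy_schwarz)
    moreover have "(u1 s - u2 s) \<bullet> (a1 s - a2 s) \<le> ?y * (A * (?x + ?y))"
      using geodesic_eq_lipschitz[OF B _ _ eq(1)[OF s] eq(2)[OF s], of V] c[OF s] V[OF s]
      unfolding A_def
      by (intro order_trans[OF norm_cauchy_schwarz] mult_left_mono) auto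
    ultimately have "E' s \<le> 2 * (?x * ?y) + 2 * (?y * (A * (?x + ?y)))"
      unfolding E'_def by linarith
    also have "\<dots> = (1 + A) * (2 * (?x * ?y)) + 2 * A * ?y\<^sup>2"
      by (simp add: algebra_simps power2_eq_square)
    also have "\<dots> \<le> (1 + A) * (?x\<^sup>2 + ?y\<^sup>2) + 2 * A * (?x\<^sup>2 + ?y\<^sup>2)"
      using sum_squares_bound[of ?x ?y] A0
      by (intro add_mono mult_left_mono) (auto simp: algebra_simps)
    also have "\<dots> = (1 + 3 * A) * E s"
      by (simp add: E_def dot_square_norm algebra_simps)
    finally show "E' s \<le> (1 + 3 * A) * E s" .
  qed (use t init in \<open>auto simp: E_def\<close>)
  then show ?thesis
    unfolding E_def by (smt (verit) inner_ge_zero inner_eq_zero_iff eq_iff_diff_eq_0)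
qed

section \<open>Geodesics in charts, velocity and constant speed\<close>

lemma geodesic_onE:
  assumes "geodesic_on M J \<gamma>"
  obtains c' c'' where
    "\<And>t. t \<in> J \<Longrightarrow> \<gamma> t \<in> chart_dom M p \<Longrightarrow> ((\<lambda>s. chart M p (\<gamma> s)) has_vector_derivative c' t) (at t within J)"
    "\<And>t. t \<in> J \<Longrightarrow> \<gamma> t \<in> chart_dom M p \<Longrightarrow> (c' has_vector_derivative c'' t) (at t within J)"
    "\<And>t. t \<in> J \<Longrightarrow> \<gamma> t \<in> chart_dom M p \<Longrightarrow> geodesic_eq p (chart M p (\<gamma> t)) (c' t) (c'' t)"
proof -
  obtain c' c'' where "\<forall>t\<in>J. \<gamma> t \<in> chart_dom M p \<longrightarrow>
        ((chart M p \<circ> \<gamma>) has_vector_derivative c' t) (at t within J) \<and>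
        (c' has_vector_derivative c'' t) (at t within J) \<and>
        (\<forall>w. coord_metric M p (chart M p (\<gamma> t)) (c'' t) w
              + christoffel M p (chart M p (\<gamma> t)) (c' t) (c' t) w = 0)"
    using assms unfolding geodesic_on_def by blast
  then show thesis using that[of c' c''] unfolding geodesic_eq_def o_def by blast
qed

lemma eventually_chart_dom:
  assumes "continuous (at t within J) \<gamma>" "\<gamma> t \<in> chart_dom M p"
  shows "\<forall>\<^sub>F s in at t within J. \<gamma> s \<in> chart_dom M p"
  using assms open_chart_dom topological_tendstoD unfolding continuous_within by metis

lemma chart_change_has_vector_derivative:
  assumes cont: "continuous (at t within J) \<gamma>" and t: "t \<in> J"
    and dom: "\<gamma> t \<in> chart_dom M p" "\<gamma> t \<in> chart_dom M q"
    and c: "((\<lambda>s. chart M p (\<gamma> s)) has_vector_derivative c') (at t within J)"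
  shows "((\<lambda>s. chart M q (\<gamma> s)) has_vector_derivative tangent_map p q (chart M p (\<gamma> t)) c') (at t within J)"
proof -
  have "((\<lambda>s. transition M p q (chart M p (\<gamma> s))) has_vector_derivative
      tangent_map p q (chart M p (\<gamma> t)) c') (at t within J)"
    using vector_derivative_diff_chain_within[OF c has_derivative_at_withinI[OF transition_has_derivative[OF dom]]]
    by (simp add: o_def)
  then show ?thesis
    unfolding has_vector_derivative_def
    by (rule has_derivative_transform_eventually)
      (use eventually_chart_dom[OF cont dom(1)] t dom(1) in \<open>auto elim!: eventually_mono simp: transition_chart\<close>)
qed

text \<open>\<open>velocity\<close> uses at each time the chart of the current point, so its
  components at different times are not directly comparable. A fixed chart \<open>p\<close> makes
  the speed accessible to calculus.\<close>

lemma velocity_eq: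
  assumes "a < b" and t: "t \<in> {a..b}" and cont: "continuous_on {a..b} \<gamma>"
    and dom: "\<gamma> t \<in> chart_dom M p"
    and c: "((\<lambda>s. chart M p (\<gamma> s)) has_vector_derivative c') (at t within {a..b})"
  shows "velocity M {a..b} \<gamma> t = tangent_map p (\<gamma> t) (chart M p (\<gamma> t)) c'"
    and "metric M (\<gamma> t) (velocity M {a..b} \<gamma> t) (velocity M {a..b} \<gamma> t) = coord_metric M p (chart M p (\<gamma> t)) c' c'"
proof -
  have "continuous (at t within {a..b}) \<gamma>"
    using cont t continuous_on_eq_continuous_within by blast
  from chart_change_has_vector_derivative[OF this t dom in_chart_dom c]
  show "velocity M {a..b} \<gamma> t = tangent_map p (\<gamma> t) (chart M p (\<gamma> t)) c'"
    unfolding velocity_def o_def using vector_derivative_within_closed_interval[OF \<open>a < b\<close> t] by blast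
  then show "metric M (\<gamma> t) (velocity M {a..b} \<gamma> t) (velocity M {a..b} \<gamma> t) = coord_metric M p (chart M p (\<gamma> t)) c' c'"
    using coord_metric_chart[OF dom] by simp
qed

text \<open>Tested with \<open>w = c'\<close>, the Christoffel term is half the derivative of the
  metric along \<open>c'\<close>. The geodesic equation is therefore half the derivative of the
  squared speed. This is checked near each time in a chart around the current point.\<close>

lemma geodesic_speed_constant:
  assumes geo: "geodesic_on M {0..1} \<gamma>" and t: "t \<in> {0..1}"
  shows "tnorm M (\<gamma> t) (velocity M {0..1} \<gamma> t) = tnorm M (\<gamma> 0) (velocity M {0..1} \<gamma> 0)"
proof -
  have cont: "continuous_on {0..1} \<gamma>" using geo unfolding geodesic_on_def by blast
  let ?s = "\<lambda>t. metric M (\<gamma> t) (velocity M {0..1} \<gamma> t) (velocity M {0..1} \<gamma> t)"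
  have "(?s has_derivative (\<lambda>h. 0)) (at t within {0..1})" if t: "t \<in> {0..1}" for t
  proof -
    define p where "p = \<gamma> t"
    have dom: "\<gamma> t \<in> chart_dom M p" by (simp add: p_def)
    obtain c' c'' where c:
      "\<And>t. t \<in> {0..1} \<Longrightarrow> \<gamma> t \<in> chart_dom M p \<Longrightarrow> ((\<lambda>s. chart M p (\<gamma> s)) has_vector_derivative c' t) (at t within {0..1})"
      "\<And>t. t \<in> {0..1} \<Longrightarrow> \<gamma> t \<in> chart_dom M p \<Longrightarrow> (c' has_vector_derivative c'' t) (at t within {0..1})"
      "\<And>t. t \<in> {0..1} \<Longrightarrow> \<gamma> t \<in> chart_dom M p \<Longrightarrow> geodesic_eq p (chart M p (\<gamma> t)) (c' t) (c'' t)"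
      using geodesic_onE[OF geo] by blast
    let ?z = "chart M p (\<gamma> t)"
    have z: "?z \<in> chart M p ` chart_dom M p" using dom by blast
    have "dmetric p ?z (c' t) (c' t) (c' t) + coord_metric M p ?z (c'' t) (c' t) + coord_metric M p ?z (c' t) (c'' t) = 0"
      using c(3)[OF t dom, unfolded geodesic_eq_def, rule_format, of "c' t"] coord_metric_sym[OF z, of "c' t" "c'' t"]
      by (simp add: christoffel_dmetric)
    then have "((\<lambda>s. coord_metric M p (chart M p (\<gamma> s)) (c' s) (c' s)) has_real_derivative 0) (at t within {0..1})"
      using coord_metric_has_real_derivative[OF z t c(1)[OF t dom] c(2)[OF t dom] c(2)[OF t dom]] by simp
    moreover have "\<forall>\<^sub>F s in at t within {0..1}. coord_metric M p (chart M p (\<gamma> s)) (c' s) (c' s) = ?s s"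
    proof -
      have "\<forall>\<^sub>F s in at t within {0..1}. \<gamma> s \<in> chart_dom M p \<and> s \<in> {0..1}"
        using cont t
        by (intro eventually_conj eventually_chart_dom dom)
          (auto simp: continuous_on_eq_continuous_within eventually_at_filter)
      then show ?thesis
        by eventually_elim (auto intro!: velocity_eq(2)[OF zero_less_one _ cont, symmetric] c(1))
    qed
    moreover have "coord_metric M p ?z (c' t) (c' t) = ?s t"
      using velocity_eq(2)[OF _ t cont dom c(1)[OF t dom]] by simp
    ultimately show ?thesis
      unfolding has_field_derivative_def lambda_zero using t
      by (simp add: has_derivative_transform_eventually)
  qed
  then have "\<exists>c. \<forall>t\<in>{0..1}. ?s t = c"
    by (intro has_derivative_zero_constant) auto
  then show ?thesis using t unfolding tnorm_def by auto
qed

end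

section \<open>Geodesics and the exponential map\<close>

context riemannian
begin

lemma geodesic_on_continuous: "geodesic_on M J \<gamma> \<Longrightarrow> continuous_on J \<gamma>"
  unfolding geodesic_on_def by blast

text \<open>For \<open>T > 0\<close> agreement on \<open>{0..T}\<close> determines the derivative at
  \<open>T\<close> from the left. At \<open>T = 0\<close> there is nothing to the left, and the
  initial velocities take over.\<close>

lemma geodesic_velocity_agree:
  assumes geo: "geodesic_on M {0..1} \<gamma>1" "geodesic_on M {0..1} \<gamma>2"
    and T: "T \<in> {0..1}" and eq: "\<And>s. s \<in> {0..T} \<Longrightarrow> \<gamma>1 s = \<gamma>2 s"
    and vel: "velocity M {0..1} \<gamma>1 0 = velocity M {0..1} \<gamma>2 0"
    and dom: "\<gamma>1 T \<in> chart_dom M p"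
    and c1: "((\<lambda>s. chart M p (\<gamma>1 s)) has_vector_derivative u1) (at T within {0..1})"
    and c2: "((\<lambda>s. chart M p (\<gamma>2 s)) has_vector_derivative u2) (at T within {0..1})"
  shows "u1 = u2"
proof (cases "T = 0")
  case True
  have e: "\<gamma>2 T = \<gamma>1 T" using eq T by simp
  have "tangent_map p (\<gamma>1 T) (chart M p (\<gamma>1 T)) u1 = tangent_map p (\<gamma>1 T) (chart M p (\<gamma>1 T)) u2"
    using velocity_eq(1)[OF zero_less_one T geodesic_on_continuous[OF geo(1)] dom c1]
      velocity_eq(1)[OF zero_less_one T geodesic_on_continuous[OF geo(2)] _ c2] dom vel True e by simp
  then show ?thesis using tangent_map_inverse[OF dom in_chart_dom] by metis
next
  case False
  then have "0 < T" using T by simp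
  have sub: "{0..T} \<subseteq> {0..1}" using T by auto
  have "((\<lambda>s. chart M p (\<gamma>1 s)) has_vector_derivative u2) (at T within {0..T})"
    by (rule has_vector_derivative_transform[OF _ _ has_vector_derivative_within_subset[OF c2 sub]])
      (use T eq in auto)
  then show ?thesis
    using vector_derivative_within_closed_interval[OF \<open>0 < T\<close>, of T]
      has_vector_derivative_within_subset[OF c1 sub] \<open>0 < T\<close> by (metis atLeastAtMost_iff less_imp_le order_refl)
qed

text \<open>Continuation argument: at the infimum \<open>T\<close> of the times of disagreement,
  positions agree because the space is Hausdorff and velocities agree by the previous lemma, so
  uniqueness in a chart extends the agreement beyond \<open>T\<close>.\<close>

lemma geodesic_unique:
  assumes geo: "geodesic_on M {0..1} \<gamma>1" "geodesic_on M {0..1} \<gamma>2"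
    and start: "\<gamma>1 0 = \<gamma>2 0"
    and vel: "velocity M {0..1} \<gamma>1 0 = velocity M {0..1} \<gamma>2 0"
    and t: "t \<in> {0..1}"
  shows "\<gamma>1 t = \<gamma>2 t"
proof (rule ccontr)
  assume neq: "\<gamma>1 t \<noteq> \<gamma>2 t"
  define B where "B = {t \<in> {0..1}. \<gamma>1 t \<noteq> \<gamma>2 t}"
  define T where "T = Inf B"
  have B: "B \<noteq> {}" "bdd_below B" using neq t by (auto simp: B_def intro!: bdd_belowI[of _ 0])
  have T0: "0 \<le> T" unfolding T_def using B by (intro cInf_greatest) (auto simp: B_def)
  have low: "T \<le> s" if "s \<in> B" for s unfolding T_def using B that by (intro cInf_lower) auto
  have T1: "T \<le> 1" using B low by (fastforce simp: B_def)
  have below: "\<gamma>1 s = \<gamma>2 s" if "0 \<le> s" "s < T" for s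
    using low[of s] that T1 unfolding B_def by force
  note cont = geodesic_on_continuous[OF geo(1)] geodesic_on_continuous[OF geo(2)]
  have eqT: "\<gamma>1 T = \<gamma>2 T"
  proof (cases "T = 0")
    case True
    then show ?thesis using start by simp
  next
    case False
    then have "0 < T" using T0 by simp
    have lim: "(\<gamma> \<longlongrightarrow> \<gamma> T) (at_left T)" if "continuous_on {0..1} \<gamma>" for \<gamma> :: "real \<Rightarrow> 'm"
    proof -
      have "continuous_on {0..T} \<gamma>" using that T1 by (auto intro: continuous_on_subset)
      then show ?thesis
        using \<open>0 < T\<close> at_within_Icc_at_left[OF \<open>0 < T\<close>] unfolding continuous_on_def
        by (metis atLeastAtMost_iff less_imp_le order_refl)
    qed
    have "\<forall>\<^sub>F s in at_left T. \<gamma>2 s = \<gamma>1 s"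
      using eventually_at_left_real[OF \<open>0 < T\<close>] by eventually_elim (use below in auto)
    then have "(\<gamma>1 \<longlongrightarrow> \<gamma>2 T) (at_left T)"
      using lim[OF cont(2)] by (rule Lim_transform_eventually[rotated])
    then show ?thesis
      using tendsto_unique[OF trivial_limit_at_left_real lim[OF cont(1)]] by blast
  qed
  have "T < 1"
  proof (rule ccontr)
    assume "\<not> T < 1"
    then have "\<gamma>1 s = \<gamma>2 s" if "s \<in> {0..1}" for s
      using below[of s] eqT T1 that by (cases "s = T") auto
    then show False using neq t by blast
  qed
  have T: "T \<in> {0..1}" using T0 T1 by simp
  define p where "p = \<gamma>1 T"
  have dom: "\<gamma>1 T \<in> chart_dom M p" "\<gamma>2 T \<in> chart_dom M p" using eqT by (auto simp: p_def)
  obtain r m K where r: "r > 0" and mb: "metric_bounds p (cball (chart M p p) r) m K"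
    using metric_bounds_around .
  obtain u1 a1 where g1:
    "\<And>t. t \<in> {0..1} \<Longrightarrow> \<gamma>1 t \<in> chart_dom M p \<Longrightarrow> ((\<lambda>s. chart M p (\<gamma>1 s)) has_vector_derivative u1 t) (at t within {0..1})"
    "\<And>t. t \<in> {0..1} \<Longrightarrow> \<gamma>1 t \<in> chart_dom M p \<Longrightarrow> (u1 has_vector_derivative a1 t) (at t within {0..1})"
    "\<And>t. t \<in> {0..1} \<Longrightarrow> \<gamma>1 t \<in> chart_dom M p \<Longrightarrow> geodesic_eq p (chart M p (\<gamma>1 t)) (u1 t) (a1 t)"
    using geodesic_onE[OF geo(1)] by blast
  obtain u2 a2 where g2:
    "\<And>t. t \<in> {0..1} \<Longrightarrow> \<gamma>2 t \<in> chart_dom M p \<Longrightarrow> ((\<lambda>s. chart M p (\<gamma>2 s)) has_vector_derivative u2 t) (at t within {0..1})"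
    "\<And>t. t \<in> {0..1} \<Longrightarrow> \<gamma>2 t \<in> chart_dom M p \<Longrightarrow> (u2 has_vector_derivative a2 t) (at t within {0..1})"
    "\<And>t. t \<in> {0..1} \<Longrightarrow> \<gamma>2 t \<in> chart_dom M p \<Longrightarrow> geodesic_eq p (chart M p (\<gamma>2 t)) (u2 t) (a2 t)"
    using geodesic_onE[OF geo(2)] by blast
  have uT: "u1 T = u2 T"
    using geodesic_velocity_agree[OF geo T _ vel dom(1) g1(1)[OF T dom(1)] g2(1)[OF T dom(2)]]
      below eqT by fastforce
  \<comment> \<open>The summand 1 makes the bound strict at \<open>T\<close>, so by continuity it
    persists for a short time.\<close>
  define V where "V = norm (u1 T) + 1"
  define P where "P \<gamma> u s \<longleftrightarrow> \<gamma> s \<in> chart_dom M p \<and> chart M p (\<gamma> s) \<in> cball (chart M p p) r \<and> norm (u s) \<le> V"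
    for \<gamma> :: "real \<Rightarrow> 'm" and u :: "real \<Rightarrow> 'e" and s
  have P: "\<forall>\<^sub>F s in at T within {0..1}. P \<gamma> u s"
    if "continuous_on {0..1} \<gamma>" "\<gamma> T = p" "(u has_vector_derivative a) (at T within {0..1})" "norm (u T) < V"
      "((\<lambda>s. chart M p (\<gamma> s)) has_vector_derivative u') (at T within {0..1})" for \<gamma> u a u'
  proof -
    have "\<forall>\<^sub>F s in at T within {0..1}. \<gamma> s \<in> chart_dom M p"
      using that(1,2) T by (intro eventually_chart_dom) (auto simp: continuous_on_eq_continuous_within)
    moreover have "\<forall>\<^sub>F s in at T within {0..1}. norm (u s) < V"
      using has_vector_derivative_imp_continuous[OF that(3)] that(4)
      unfolding continuous_within by (intro order_tendstoD(2)[OF tendsto_norm]) auto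
    moreover have "\<forall>\<^sub>F s in at T within {0..1}. dist (chart M p (\<gamma> s)) (chart M p p) < r"
      using has_vector_derivative_imp_continuous[OF that(5)] that(2) r
      unfolding continuous_within by (auto intro: tendstoD)
    ultimately show ?thesis by eventually_elim (auto simp: P_def dist_commute)
  qed
  have "\<forall>\<^sub>F s in at T within {0..1}. P \<gamma>1 u1 s \<and> P \<gamma>2 u2 s"
    using P[OF cont(1) _ g1(2)[OF T dom(1)] _ g1(1)[OF T dom(1)]]
      P[OF cont(2) _ g2(2)[OF T dom(2)] _ g2(1)[OF T dom(2)]] eqT uT
    by (auto intro!: eventually_conj simp: p_def V_def)
  moreover have "P \<gamma>1 u1 T \<and> P \<gamma>2 u2 T"
    using dom eqT uT r by (auto simp: P_def p_def V_def)
  ultimately obtain \<delta> where \<delta>: "\<delta> > 0" "T + \<delta> \<le> 1"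
    and P\<delta>: "\<And>s. s \<in> {T..T + \<delta>} \<Longrightarrow> P \<gamma>1 u1 s \<and> P \<gamma>2 u2 s"
    using eventually_within_subset_interval[OF _ _ T0 \<open>T < 1\<close>] by blast
  have sub: "{T..T + \<delta>} \<subseteq> {0..1}" using T0 \<delta> by auto
  note within = has_vector_derivative_within_subset[OF _ sub]
  have ext: "\<gamma>1 s = \<gamma>2 s" if s: "s \<in> {T..T + \<delta>}" for s
  proof -
    have "chart M p (\<gamma>1 s) = chart M p (\<gamma>2 s)"
    proof (rule coordinate_geodesic_unique[OF mb, of T "T + \<delta>", where V = V])
      fix s assume s: "s \<in> {T..T + \<delta>}"
      then have s1: "s \<in> {0..1}" using sub by blast
      have d: "\<gamma>1 s \<in> chart_dom M p" "\<gamma>2 s \<in> chart_dom M p" using P\<delta>[OF s] by (auto simp: P_def)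
      show "((\<lambda>s. chart M p (\<gamma>1 s)) has_vector_derivative u1 s) (at s within {T..T + \<delta>})"
        by (rule within[OF g1(1)[OF s1 d(1)]])
      show "((\<lambda>s. chart M p (\<gamma>2 s)) has_vector_derivative u2 s) (at s within {T..T + \<delta>})"
        by (rule within[OF g2(1)[OF s1 d(2)]])
      show "(u1 has_vector_derivative a1 s) (at s within {T..T + \<delta>})"
        by (rule within[OF g1(2)[OF s1 d(1)]])
      show "(u2 has_vector_derivative a2 s) (at s within {T..T + \<delta>})"
        by (rule within[OF g2(2)[OF s1 d(2)]])
      show "geodesic_eq p (chart M p (\<gamma>1 s)) (u1 s) (a1 s)" by (rule g1(3)[OF s1 d(1)])
      show "geodesic_eq p (chart M p (\<gamma>2 s)) (u2 s) (a2 s)" by (rule g2(3)[OF s1 d(2)])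
    qed (use P\<delta> s \<delta> eqT uT in \<open>auto simp: P_def\<close>)
    then show ?thesis using P\<delta>[OF s] chart_inv_chart unfolding P_def by metis
  qed
  have "T + \<delta> \<le> Inf B"
  proof (rule cInf_greatest[OF B(1)])
    fix s assume "s \<in> B"
    then show "T + \<delta> \<le> s" using ext[of s] low[of s] unfolding B_def by force
  qed
  then show False using \<delta>(1) by (simp add: T_def)
qed

section \<open>Reparametrisation and evaluation of the exponential map\<close>

lemma christoffel_scaleR:
  assumes z: "z \<in> chart M p ` chart_dom M p"
  shows "christoffel M p z (s *\<^sub>R u) (s *\<^sub>R u) w = s\<^sup>2 * christoffel M p z u u w"
  by (simp add: christoffel_dmetric linear_scale[OF linear_dmetric[OF z]]
      bilinear_lmul[OF bilinear_dmetric[OF z]] bilinear_rmul[OF bilinear_dmetric[OF z]]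
      power2_eq_square field_simps)

text \<open>Slowing down by \<open>s\<close> scales the acceleration by \<open>s\<^sup>2\<close>,
  and so it does the Christoffel term, which is quadratic in the velocity. For \<open>s\<close> in
  the unit interval the new curve uses only times where the old one is defined.\<close>

lemma geodesic_reparam:
  assumes geo: "geodesic_on M {0..1} \<gamma>" and s: "s \<in> {0..1}"
  shows "geodesic_on M {0..1} (\<lambda>t. \<gamma> (s * t))"
    and "velocity M {0..1} (\<lambda>t. \<gamma> (s * t)) 0 = s *\<^sub>R velocity M {0..1} \<gamma> 0"
proof -
  have img: "(*) s ` {0..1} \<subseteq> {0..1::real}" using s by (auto simp: mult_le_one)
  have chain: "((\<lambda>t. h (s * t)) has_vector_derivative s *\<^sub>R h') (at t within {0..1})"
    if "(h has_vector_derivative h') (at (s * t) within {0..1})" for h :: "real \<Rightarrow> 'e" and h' t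
  proof -
    have "((*) s has_vector_derivative s) (at t within {0..1})"
      by (auto intro!: derivative_eq_intros simp: has_vector_derivative_def)
    from vector_diff_chain_within[OF this has_vector_derivative_within_subset[OF that img]]
    show ?thesis by (simp add: o_def)
  qed
  show "geodesic_on M {0..1} (\<lambda>t. \<gamma> (s * t))"
    unfolding geodesic_on_def
  proof (intro conjI allI)
    show "continuous_on {0..1} (\<lambda>t. \<gamma> (s * t))"
      using img by (intro continuous_on_compose2[OF geodesic_on_continuous[OF geo]] continuous_intros)
    fix p
    obtain c' c'' where c:
      "\<And>t. t \<in> {0..1} \<Longrightarrow> \<gamma> t \<in> chart_dom M p \<Longrightarrow> ((\<lambda>s. chart M p (\<gamma> s)) has_vector_derivative c' t) (at t within {0..1})"
      "\<And>t. t \<in> {0..1} \<Longrightarrow> \<gamma> t \<in> chart_dom M p \<Longrightarrow> (c' has_vector_derivative c'' t) (at t within {0..1})"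
      "\<And>t. t \<in> {0..1} \<Longrightarrow> \<gamma> t \<in> chart_dom M p \<Longrightarrow> geodesic_eq p (chart M p (\<gamma> t)) (c' t) (c'' t)"
      using geodesic_onE[OF geo] by blast
    show "\<exists>u a. \<forall>t\<in>{0..1}. \<gamma> (s * t) \<in> chart_dom M p \<longrightarrow>
        ((chart M p \<circ> (\<lambda>t. \<gamma> (s * t))) has_vector_derivative u t) (at t within {0..1}) \<and>
        (u has_vector_derivative a t) (at t within {0..1}) \<and>
        (\<forall>w. coord_metric M p (chart M p (\<gamma> (s * t))) (a t) w
              + christoffel M p (chart M p (\<gamma> (s * t))) (u t) (u t) w = 0)"
    proof (intro exI ballI impI conjI allI)
      fix t w assume t: "t \<in> {0..1}" and dom: "\<gamma> (s * t) \<in> chart_dom M p"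
      have st: "s * t \<in> {0..1}" using img t by blast
      have z: "chart M p (\<gamma> (s * t)) \<in> chart M p ` chart_dom M p" using dom by blast
      show "((chart M p \<circ> (\<lambda>t. \<gamma> (s * t))) has_vector_derivative s *\<^sub>R c' (s * t)) (at t within {0..1})"
        using chain[OF c(1)[OF st dom]] by (simp add: o_def)
      show "((\<lambda>t. s *\<^sub>R c' (s * t)) has_vector_derivative s *\<^sub>R s *\<^sub>R c'' (s * t)) (at t within {0..1})"
        by (rule bounded_linear.has_vector_derivative[OF bounded_linear_scaleR_right chain[OF c(2)[OF st dom]]])
      have "s\<^sup>2 * (coord_metric M p (chart M p (\<gamma> (s * t))) (c'' (s * t)) w
              + christoffel M p (chart M p (\<gamma> (s * t))) (c' (s * t)) (c' (s * t)) w) = 0"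
        using c(3)[OF st dom] unfolding geodesic_eq_def by simp
      then show "coord_metric M p (chart M p (\<gamma> (s * t))) (s *\<^sub>R s *\<^sub>R c'' (s * t)) w
              + christoffel M p (chart M p (\<gamma> (s * t))) (s *\<^sub>R c' (s * t)) (s *\<^sub>R c' (s * t)) w = 0"
        by (simp add: christoffel_scaleR[OF z] bilinear_lmul[OF bilinear_coord_metric[OF z]]
            power2_eq_square distrib_left)
    qed
  qed
  obtain c' c'' where c:
      "\<And>t. t \<in> {0..1} \<Longrightarrow> \<gamma> t \<in> chart_dom M (\<gamma> 0) \<Longrightarrow>
        ((\<lambda>s. chart M (\<gamma> 0) (\<gamma> s)) has_vector_derivative c' t) (at t within {0..1})"
    by (rule geodesic_onE[OF geo, of "\<gamma> 0"], rule that)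
  have c0: "((\<lambda>s. chart M (\<gamma> 0) (\<gamma> s)) has_vector_derivative c' 0) (at 0 within {0..1})"
    by (intro c) auto
  have "((\<lambda>t. chart M (\<gamma> 0) (\<gamma> (s * t))) has_vector_derivative s *\<^sub>R c' 0) (at 0 within {0..1})"
    by (rule chain) (simp add: c0)
  then have "vector_derivative (\<lambda>t. chart M (\<gamma> 0) (\<gamma> (s * t))) (at 0 within {0..1}) = s *\<^sub>R c' 0"
    by (intro vector_derivative_within_closed_interval) auto
  moreover have "vector_derivative (\<lambda>t. chart M (\<gamma> 0) (\<gamma> t)) (at 0 within {0..1}) = c' 0"
    by (intro vector_derivative_within_closed_interval c0) auto
  ultimately show "velocity M {0..1} (\<lambda>t. \<gamma> (s * t)) 0 = s *\<^sub>R velocity M {0..1} \<gamma> 0"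
    by (simp add: velocity_def o_def)
qed

text \<open>\<open>Exp\<close> is a definite description: the reparametrised geodesic is a witness
  and \<open>geodesic_unique\<close> makes its end point the only candidate.\<close>

lemma Exp_geodesic:
  assumes geo: "geodesic_on M {0..1} \<gamma>" and s: "s \<in> {0..1}"
  shows "Exp M (\<gamma> 0) (s *\<^sub>R velocity M {0..1} \<gamma> 0) = \<gamma> s"
  unfolding Exp_def
proof (rule the_equality)
  show "\<exists>\<gamma>'. geodesic_on M {0..1} \<gamma>' \<and> \<gamma>' 0 = \<gamma> 0 \<and>
      velocity M {0..1} \<gamma>' 0 = s *\<^sub>R velocity M {0..1} \<gamma> 0 \<and> \<gamma>' 1 = \<gamma> s"
    using geodesic_reparam[OF geo s] by (intro exI[of _ "\<lambda>t. \<gamma> (s * t)"]) simp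
next
  fix y
  assume "\<exists>\<gamma>'. geodesic_on M {0..1} \<gamma>' \<and> \<gamma>' 0 = \<gamma> 0 \<and>
      velocity M {0..1} \<gamma>' 0 = s *\<^sub>R velocity M {0..1} \<gamma> 0 \<and> \<gamma>' 1 = y"
  then obtain \<gamma>' where \<gamma>': "geodesic_on M {0..1} \<gamma>'" "\<gamma>' 0 = \<gamma> 0"
    "velocity M {0..1} \<gamma>' 0 = s *\<^sub>R velocity M {0..1} \<gamma> 0" "\<gamma>' 1 = y" by blast
  then have "\<gamma>' 1 = \<gamma> (s * 1)"
    using geodesic_unique[OF \<gamma>'(1) geodesic_reparam(1)[OF geo s], of 1] geodesic_reparam(2)[OF geo s] by simp
  then show "y = \<gamma> s" using \<gamma>'(4) by simp
qed

lemma curve_length_geodesic: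
  assumes geo: "geodesic_on M {0..1} \<gamma>"
  shows "curve_length M \<gamma> = tnorm M (\<gamma> 0) (velocity M {0..1} \<gamma> 0)"
proof -
  have "curve_length M \<gamma> = integral {0..1::real} (\<lambda>t. tnorm M (\<gamma> 0) (velocity M {0..1} \<gamma> 0))"
    unfolding curve_length_def
    by (rule Henstock_Kurzweil_Integration.integral_cong[OF geodesic_speed_constant[OF geo]])
  then show ?thesis by simp
qed

text \<open>Constant speed on a unit interval makes the length equal to the norm of the initial
  velocity. This is the way weak convexity produces elements of
  \<open>feasible_velocities\<close>.\<close>

lemma minimizing_geodesic_feasible:
  assumes geo: "minimizing_geodesic M x y \<gamma>" and X: "\<gamma> ` {0..1} \<subseteq> X"
  defines "v \<equiv> velocity M {0..1} \<gamma> 0"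
  shows "v \<in> feasible_velocities M X x" "tnorm M x v = riem_dist M x y" "Exp M x v = y"
    "s \<in> {0..1} \<Longrightarrow> Exp M x (s *\<^sub>R v) = \<gamma> s"
proof -
  have g: "geodesic_on M {0..1} \<gamma>" "\<gamma> 0 = x" "\<gamma> 1 = y" "curve_length M \<gamma> = riem_dist M x y"
    using geo unfolding minimizing_geodesic_def by auto
  show exp: "Exp M x (s *\<^sub>R v) = \<gamma> s" if "s \<in> {0..1}" for s
    using Exp_geodesic[OF g(1) that] g(2) by (simp add: v_def)
  show y: "Exp M x v = y" using exp[of 1] g(3) by simp
  show n: "tnorm M x v = riem_dist M x y" using curve_length_geodesic[OF g(1)] g by (simp add: v_def)
  show "v \<in> feasible_velocities M X x"
    unfolding feasible_velocities_def mem_Collect_eq y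
  proof (intro conjI ballI)
    show "y \<in> X" using X g(3) by auto
    show "Exp M x (s *\<^sub>R v) \<in> X" if "s \<in> {0..1}" for s using X exp that by auto
  qed (rule n)
qed

end

section \<open>Gradients and the Riemannian distance\<close>

text \<open>Write \<open>B g\<close> as the Euclidean product with a linear image of
  \<open>g\<close>; definiteness makes this map injective, hence surjective in finite dimension. It
  makes the description in \<open>grad\<close> proper.\<close>

lemma positive_definite_representer:
  fixes B :: "'a::euclidean_space \<Rightarrow> 'a \<Rightarrow> real"
  assumes B: "bilinear B" and pos: "\<And>u. u \<noteq> 0 \<Longrightarrow> B u u > 0" and F: "linear F"
  shows "\<exists>!g. \<forall>v. B g v = F v"
proof -
  define \<Phi> where "\<Phi> g = (\<Sum>b\<in>Basis. B g b *\<^sub>R b)" for g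
  have lin: "linear (\<lambda>g. B g v)" "linear (B g)" for g v
    using B unfolding bilinear_def by blast+
  have \<Phi>: "B g v = \<Phi> g \<bullet> v" for g v
  proof -
    have "B g v = B g (\<Sum>b\<in>Basis. (v \<bullet> b) *\<^sub>R b)" by (simp add: euclidean_representation)
    also have "\<dots> = (\<Sum>b\<in>Basis. (v \<bullet> b) * B g b)"
      by (simp add: linear_sum[OF lin(2)] linear_scale[OF lin(2)])
    also have "\<dots> = \<Phi> g \<bullet> v"
      by (simp add: \<Phi>_def inner_sum_left inner_commute[of v] mult.commute)
    finally show ?thesis .
  qed
  have "linear \<Phi>"
    unfolding \<Phi>_def
    by (rule linearI) (simp_all add: linear_add[OF lin(1)] linear_scale[OF lin(1)]
        scaleR_add_left sum.distrib scaleR_sum_right)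
  moreover have inj: "inj \<Phi>"
  proof -
    have "g = 0" if "\<Phi> g = 0" for g using pos[of g] \<Phi>[of g g] that by fastforce
    then show ?thesis using linear_injective_0[OF \<open>linear \<Phi>\<close>] by blast
  qed
  ultimately have "surj \<Phi>" by (rule linear_injective_imp_surjective) (rule refl)
  then obtain g where g: "\<Phi> g = (\<Sum>b\<in>Basis. F b *\<^sub>R b)" by (metis surjD)
  have "B g v = F v" for v
  proof -
    have "F v = F (\<Sum>b\<in>Basis. (v \<bullet> b) *\<^sub>R b)" by (simp add: euclidean_representation)
    also have "\<dots> = (\<Sum>b\<in>Basis. (v \<bullet> b) * F b)" by (simp add: linear_sum[OF F] linear_scale[OF F])
    also have "\<dots> = \<Phi> g \<bullet> v" by (simp add: g inner_sum_left inner_commute[of v] mult.commute)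
    finally show ?thesis by (simp add: \<Phi>)
  qed
  moreover have "g' = g" if "\<forall>v. B g' v = F v" for g'
  proof -
    have "\<Phi> g' \<bullet> v = \<Phi> g \<bullet> v" for v
      using that \<open>\<And>v. B g v = F v\<close> \<Phi> by metis
    then have "\<Phi> g' = \<Phi> g" by (metis vector_eq_rdot)
    then show ?thesis using inj by (rule injD[rotated])
  qed
  ultimately show ?thesis by blast
qed

context riemannian
begin

lemma differentiable_has_derivative:
  assumes "differentiable_at M f x"
  shows "((f \<circ> chart_inv M x) has_derivative differential M f x) (at (chart M x x))"
  using assms unfolding differentiable_at_def differential_def frechet_derivative_works .

lemma differentiable_at_isCont:
  assumes "differentiable_at M f x"
  shows "isCont f x"
proof -
  have "isCont (f \<circ> chart_inv M x) (chart M x x)"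
    using differentiable_has_derivative[OF assms] has_derivative_continuous by blast
  then have "isCont (\<lambda>y. (f \<circ> chart_inv M x) (chart M x y)) x"
    using isCont_chart[OF in_chart_dom] by (rule isCont_o2[rotated])
  moreover have "\<forall>\<^sub>F y in nhds x. (f \<circ> chart_inv M x) (chart M x y) = f y"
    using eventually_nhds_in_open[OF open_chart_dom in_chart_dom] by eventually_elim simp
  ultimately show ?thesis by (simp add: isCont_cong)
qed

lemma metric_grad:
  assumes "differentiable_at M f x"
  shows "metric M x (grad M f x) v = differential M f x v"
proof -
  have "linear (differential M f x)"
    using differentiable_has_derivative[OF assms] has_derivative_linear by blast
  then have "\<exists>!g. \<forall>v. metric M x g v = differential M f x v"
    by (intro positive_definite_representer bilinear_metric metric_pos)
  then have "\<forall>v. metric M x (grad M f x) v = differential M f x v"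
    unfolding grad_def by (rule theI')
  then show ?thesis by blast
qed

lemma chart_expression_has_derivative:
  assumes f: "differentiable_at M f x" and x: "x \<in> chart_dom M p"
  shows "((f \<circ> chart_inv M p) has_derivative
      (\<lambda>u. differential M f x (tangent_map p x (chart M p x) u))) (at (chart M p x))"
proof -
  let ?S = "chart M p ` (chart_dom M p \<inter> chart_dom M x)"
  have S: "open ?S" "chart M p x \<in> ?S"
    using x open_chart_dom by (auto intro!: open_chart_image_subset)
  have "((f \<circ> chart_inv M x) \<circ> transition M p x has_derivative
      differential M f x \<circ> tangent_map p x (chart M p x)) (at (chart M p x))"
    by (rule diff_chain_at[OF transition_has_derivative[OF x in_chart_dom]])
      (simp add: transition_chart[OF x] differentiable_has_derivative[OF f])
  then show ?thesis
    unfolding o_def[of "differential M f x"]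
    by (rule has_derivative_transform_within_open[OF _ S]) (auto simp: transition_chart)
qed

lemma along_curve_has_derivative:
  assumes f: "differentiable_at M f (\<gamma> t)" and t: "t \<in> J" and cont: "continuous (at t within J) \<gamma>"
    and dom: "\<gamma> t \<in> chart_dom M p"
    and c: "((\<lambda>s. chart M p (\<gamma> s)) has_vector_derivative c') (at t within J)"
  shows "((\<lambda>s. f (\<gamma> s)) has_real_derivative
     differential M f (\<gamma> t) (tangent_map p (\<gamma> t) (chart M p (\<gamma> t)) c')) (at t within J)"
proof -
  have "((\<lambda>s. (f \<circ> chart_inv M p) (chart M p (\<gamma> s))) has_vector_derivative
      differential M f (\<gamma> t) (tangent_map p (\<gamma> t) (chart M p (\<gamma> t)) c')) (at t within J)"
    using vector_derivative_diff_chain_within[OF c has_derivative_at_withinI[OF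
        chart_expression_has_derivative[OF f dom]]]
    by (simp add: o_def)
  then show ?thesis
    unfolding has_real_derivative_iff_has_vector_derivative has_vector_derivative_def
    by (rule has_derivative_transform_eventually)
      (use eventually_chart_dom[OF cont dom] t dom in \<open>auto elim!: eventually_mono\<close>)
qed

text \<open>For a non-integrable speed \<open>integral\<close> has the default value 0. So the bound
  holds for every curve, and the set of lengths in \<open>riem_dist\<close> is bounded
  below.\<close>

lemma curve_length_nonneg: "curve_length M \<gamma> \<ge> 0"
proof (cases "(\<lambda>t. tnorm M (\<gamma> t) (velocity M {0..1} \<gamma> t)) integrable_on {0..1}")
  case True
  then show ?thesis unfolding curve_length_def
    by (rule Henstock_Kurzweil_Integration.integral_nonneg) (rule tnorm_nonneg)
qed (simp add: curve_length_def not_integrable_integral)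

lemma riem_dist_le_curve_length:
  "piecewise_C1_curve M \<gamma> \<Longrightarrow> riem_dist M (\<gamma> 0) (\<gamma> 1) \<le> curve_length M \<gamma>"
  unfolding riem_dist_def
  by (intro cInf_lower bdd_belowI[of _ 0]) (auto simp: curve_length_nonneg)

text \<open>A competitor in \<open>riem_dist\<close> must be C1 in every chart \<open>q\<close>.
  There its derivative is the tangent map from \<open>p\<close> to \<open>q\<close> along the
  segment, applied to \<open>u\<close>, and this is continuous since transitions are smooth.\<close>

lemma C1_curve_on_chart_segment:
  assumes ab: "a < b" and l: "\<And>t. t \<in> {a..b} \<Longrightarrow> z + t *\<^sub>R u \<in> chart M p ` chart_dom M p"
  shows "C1_curve_on M {a..b} (\<lambda>t. chart_inv M p (z + t *\<^sub>R u))"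
    and "t \<in> {a..b} \<Longrightarrow>
      ((\<lambda>s. chart M p (chart_inv M p (z + s *\<^sub>R u))) has_vector_derivative u) (at t within {a..b})"
proof -
  let ?l = "\<lambda>t. z + t *\<^sub>R u" and ?\<sigma> = "\<lambda>t. chart_inv M p (z + t *\<^sub>R u)"
  have cont: "continuous_on {a..b} ?\<sigma>"
    using l by (intro continuous_on_compose2[OF continuous_on_chart_inv] continuous_intros) auto
  have der: "((\<lambda>s. chart M p (?\<sigma> s)) has_vector_derivative u) (at t within {a..b})" if t: "t \<in> {a..b}" for t
  proof (rule has_vector_derivative_transform[OF t])
    show "(?l has_vector_derivative u) (at t within {a..b})"
      by (auto intro!: derivative_eq_intros simp: has_vector_derivative_def)
  qed (use l in auto)
  then show "t \<in> {a..b} \<Longrightarrow>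
      ((\<lambda>s. chart M p (chart_inv M p (z + s *\<^sub>R u))) has_vector_derivative u) (at t within {a..b})" .
  show "C1_curve_on M {a..b} ?\<sigma>"
    unfolding C1_curve_on_def
  proof (intro conjI allI)
    fix q
    show "\<exists>c'. \<forall>t\<in>{a..b}. ?\<sigma> t \<in> chart_dom M q \<longrightarrow>
        ((chart M q \<circ> ?\<sigma>) has_vector_derivative c' t) (at t within {a..b}) \<and>
        continuous (at t within {a..b}) c'"
    proof (intro exI ballI impI conjI)
      fix t assume t: "t \<in> {a..b}" and dom: "?\<sigma> t \<in> chart_dom M q"
      have "continuous (at t within {a..b}) ?\<sigma>"
        using cont t by (simp add: continuous_on_eq_continuous_within)
      from chart_change_has_vector_derivative[OF this t chart_inv_in_dom[OF l[OF t]] dom der[OF t]]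
      show "((chart M q \<circ> ?\<sigma>) has_vector_derivative tangent_map p q (?l t) u) (at t within {a..b})"
        using l[OF t] by (simp add: o_def)
      let ?S = "chart M p ` (chart_dom M p \<inter> chart_dom M q)"
      have "open ?S" using open_chart_dom by (auto intro!: open_chart_image_subset)
      moreover have "?l t \<in> ?S"
        using chart_chart_inv[OF l[OF t]] chart_inv_in_dom[OF l[OF t]] dom by (metis IntI imageI)
      moreover have "continuous_on ?S (\<lambda>z. tangent_map p q z u)"
        unfolding tangent_map_def
        by (rule smooth_on_continuous[OF smooth_on_frechet_derivative[OF smooth_transition]])
      ultimately have "isCont (\<lambda>z. tangent_map p q z u) (?l t)"
        using continuous_on_eq_continuous_at by blast
      then have "isCont (\<lambda>t. tangent_map p q (?l t) u) t"
        by (intro isCont_o2[of t ?l "\<lambda>z. tangent_map p q z u"] continuous_intros)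
      then show "continuous (at t within {a..b}) (\<lambda>t. tangent_map p q (?l t) u)"
        by (rule continuous_at_imp_continuous_at_within)
    qed
  qed (rule cont)
qed

text \<open>The coordinate segment stays in the convex ball and has Riemannian speed at most
  \<open>sqrt K\<close> times the Euclidean one.\<close>

lemma riem_dist_le_coordinate_dist:
  assumes mb: "metric_bounds p (cball a r) m K" and z: "z0 \<in> cball a r" "z1 \<in> cball a r"
  shows "riem_dist M (chart_inv M p z0) (chart_inv M p z1) \<le> sqrt K * dist z0 z1"
proof -
  let ?l = "\<lambda>t. z0 + t *\<^sub>R (z1 - z0)" and ?\<sigma> = "\<lambda>t. chart_inv M p (z0 + t *\<^sub>R (z1 - z0))"
  have lc: "?l t \<in> cball a r" if "t \<in> {0..1}" for t
  proof -
    have "(1 - t) *\<^sub>R z0 + t *\<^sub>R z1 \<in> cball a r"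
      using that z by (intro convexD[OF convex_cball]) auto
    then show ?thesis by (simp add: algebra_simps)
  qed
  then have li: "?l t \<in> chart M p ` chart_dom M p" if "t \<in> {0..1}" for t
    using that metric_boundsD(3)[OF mb] by blast
  have C1: "C1_curve_on M {a..b} ?\<sigma>" if "0 \<le> a" "a < b" "b \<le> 1" for a b
    using that by (intro C1_curve_on_chart_segment(1) li) auto
  have cont: "continuous_on {0..1} ?\<sigma>" using C1[of 0 1] by (simp add: C1_curve_on_def)
  have "piecewise_C1_curve M ?\<sigma>"
    unfolding piecewise_C1_curve_def using cont C1 by blast
  then have "riem_dist M (?\<sigma> 0) (?\<sigma> 1) \<le> curve_length M ?\<sigma>"
    by (rule riem_dist_le_curve_length)
  also have "\<dots> \<le> sqrt K * dist z0 z1"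
  proof (cases "(\<lambda>t. tnorm M (?\<sigma> t) (velocity M {0..1} ?\<sigma> t)) integrable_on {0..1}")
    case True
    have "tnorm M (?\<sigma> t) (velocity M {0..1} ?\<sigma> t) \<le> sqrt K * dist z0 z1" if t: "t \<in> {0..1}" for t
    proof -
      have "metric M (?\<sigma> t) (velocity M {0..1} ?\<sigma> t) (velocity M {0..1} ?\<sigma> t)
          = coord_metric M p (?l t) (z1 - z0) (z1 - z0)"
        using velocity_eq(2)[OF zero_less_one t cont chart_inv_in_dom[OF li[OF t]]
            C1_curve_on_chart_segment(2)[OF zero_less_one li t]] li[OF t]
        by simp
      also have "\<dots> \<le> K * norm (z1 - z0) * norm (z1 - z0)"
        using metric_boundsD(5)[OF mb lc[OF t], of "z1 - z0" "z1 - z0"] by linarith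
      finally have "tnorm M (?\<sigma> t) (velocity M {0..1} ?\<sigma> t) \<le> sqrt (K * norm (z1 - z0) * norm (z1 - z0))"
        unfolding tnorm_def by (rule real_sqrt_le_mono)
      then show ?thesis by (simp add: real_sqrt_mult dist_norm norm_minus_commute mult.assoc)
    qed
    then have "curve_length M ?\<sigma> \<le> integral {0..1::real} (\<lambda>t. sqrt K * dist z0 z1)"
      unfolding curve_length_def
      by (intro Henstock_Kurzweil_Integration.integral_le[OF True]) auto
    then show ?thesis by simp
  next
    case False
    then show ?thesis
      using metric_boundsD(2)[OF mb] by (simp add: curve_length_def not_integrable_integral)
  qed
  finally show ?thesis by simp
qed

end

section \<open>Short minimizing geodesics\<close>

lemma vector_derivative_bound:
  fixes f :: "real \<Rightarrow> 'a::real_normed_vector"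
  assumes "a \<le> b" and f: "\<And>t. t \<in> {a..b} \<Longrightarrow> (f has_vector_derivative f' t) (at t within {a..b})"
    and B: "\<And>t. t \<in> {a..b} \<Longrightarrow> norm (f' t) \<le> B"
  shows "norm (f b - f a) \<le> B * (b - a)"
proof -
  have "norm (f b - f a) \<le> B * norm (b - a)"
  proof (rule differentiable_bound[OF convex_real_interval(5)[of a b]])
    fix t assume t: "t \<in> {a..b}"
    show "(f has_derivative (\<lambda>h. h *\<^sub>R f' t)) (at t within {a..b})"
      using f[OF t] unfolding has_vector_derivative_def .
    show "onorm (\<lambda>h. h *\<^sub>R f' t) \<le> B"
      by (rule onorm_le) (use B[OF t] in \<open>simp add: mult.commute[of "\<bar>_\<bar>"] mult_right_mono\<close>)
  qed (use \<open>a \<le> b\<close> in auto)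
  then show ?thesis using \<open>a \<le> b\<close> by simp
qed

context riemannian
begin

lemma coordinate_velocity_le:
  assumes mb: "metric_bounds p S m K" and z: "z \<in> S" and d: "coord_metric M p z u u \<le> K * d\<^sup>2" and "0 \<le> d"
  shows "norm u \<le> sqrt (K / m) * d"
proof -
  have m: "0 < m" "0 < K" using metric_boundsD[OF mb] by auto
  have "m * (norm u)\<^sup>2 \<le> K * d\<^sup>2" using metric_boundsD(4)[OF mb z] d by (rule order_trans)
  then have "(norm u)\<^sup>2 \<le> K / m * d\<^sup>2" using m by (simp add: field_simps)
  then have "norm u \<le> sqrt (K / m * d\<^sup>2)" by (rule real_le_rsqrt)
  then show ?thesis using \<open>0 \<le> d\<close> by (simp only: real_sqrt_mult) simp
qed

text \<open>The constant speed equals the distance of the end points, hence is at most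
  \<open>sqrt K * dist z0 z1\<close>. So the coordinate speed is at most
  \<open>\<kappa> \<le> r / 4\<close> and the curve stays in the ball. The geodesic equation then
  bounds the acceleration, and two integrations over unit time compare the initial velocity with the
  displacement.\<close>

lemma short_minimizing_geodesic:
  assumes mb: "metric_bounds p (cball a r) m K" and "0 < r"
    and z: "dist a z0 \<le> r / 2" "z1 \<in> cball a r" and short: "sqrt (K / m) * dist z0 z1 \<le> r / 4"
    and geo: "minimizing_geodesic M (chart_inv M p z0) (chart_inv M p z1) \<gamma>"
  shows "\<exists>u. ((\<lambda>s. chart M p (\<gamma> s)) has_vector_derivative u) (at 0 within {0..1}) \<and>
     norm (u - (z1 - z0)) \<le> (K / m)\<^sup>2 * (dist z0 z1)\<^sup>2"
proof -
  define \<kappa> where "\<kappa> = sqrt (K / m) * dist z0 z1"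
  let ?c = "\<lambda>s. chart M p (\<gamma> s)"
  \<comment> \<open>\<open>O'\<close> is the region where the coordinate bounds apply. The smaller
    \<open>C'\<close> is where the speed bound confines the curve: its start is within
    \<open>r / 2\<close> of \<open>a\<close> and it travels at most \<open>r / 4\<close>.\<close>
  define O' where "O' = chart_inv M p ` ball a r"
  define C' where "C' = chart_inv M p ` cball a (3 * r / 4)"
  have mK: "0 < m" "0 < K" using metric_boundsD[OF mb] by auto
  have sub: "cball a r \<subseteq> chart M p ` chart_dom M p" by (rule metric_boundsD(3)[OF mb])
  have ballsub: "ball a r \<subseteq> chart M p ` chart_dom M p" using sub ball_subset_cball by blast
  have Osub: "\<gamma>' \<in> chart_dom M p" "chart M p \<gamma>' \<in> ball a r" if "\<gamma>' \<in> O'" for \<gamma>'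
    using that ballsub chart_inv_in_dom unfolding O'_def by fastforce+
  have z0: "z0 \<in> ball a r" using z \<open>0 < r\<close> by auto
  have z0r: "z0 \<in> cball a r" using z0 by simp
  have "cball a (3 * r / 4) \<subseteq> ball a r" using \<open>0 < r\<close> by (auto simp: cball_subset_ball_iff)
  then have CO: "C' \<subseteq> O'" unfolding O'_def C'_def by blast
  have "open O'" unfolding O'_def using ballsub by (intro open_chart_inv_image) auto
  \<comment> \<open>Compactness in a Hausdorff space makes \<open>C'\<close> closed in the whole
    manifold, not merely in the chart domain.\<close>
  have "closed C'"
    unfolding C'_def using \<open>cball a (3 * r / 4) \<subseteq> ball a r\<close> ballsub
    by (intro compact_imp_closed compact_continuous_image continuous_on_subset[OF continuous_on_chart_inv]) auto
  have g: "geodesic_on M {0..1} \<gamma>" "\<gamma> 0 = chart_inv M p z0" "\<gamma> 1 = chart_inv M p z1"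
    "curve_length M \<gamma> = riem_dist M (chart_inv M p z0) (chart_inv M p z1)"
    using geo unfolding minimizing_geodesic_def by auto
  note cont = geodesic_on_continuous[OF g(1)]
  obtain c' c'' where c:
    "\<And>t. t \<in> {0..1} \<Longrightarrow> \<gamma> t \<in> chart_dom M p \<Longrightarrow> (?c has_vector_derivative c' t) (at t within {0..1})"
    "\<And>t. t \<in> {0..1} \<Longrightarrow> \<gamma> t \<in> chart_dom M p \<Longrightarrow> (c' has_vector_derivative c'' t) (at t within {0..1})"
    "\<And>t. t \<in> {0..1} \<Longrightarrow> \<gamma> t \<in> chart_dom M p \<Longrightarrow> geodesic_eq p (?c t) (c' t) (c'' t)"
    using geodesic_onE[OF g(1)] by blast
  have speed: "norm (c' t) \<le> \<kappa>" if t: "t \<in> {0..1}" "\<gamma> t \<in> O'" for t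
  proof -
    have "coord_metric M p (?c t) (c' t) (c' t) = (tnorm M (\<gamma> t) (velocity M {0..1} \<gamma> t))\<^sup>2"
      using velocity_eq(2)[OF zero_less_one t(1) cont Osub(1)[OF t(2)] c(1)[OF t(1) Osub(1)[OF t(2)]]]
      by (simp add: tnorm_power2)
    also have "tnorm M (\<gamma> t) (velocity M {0..1} \<gamma> t) = riem_dist M (chart_inv M p z0) (chart_inv M p z1)"
      using geodesic_speed_constant[OF g(1) t(1)] curve_length_geodesic[OF g(1)] g(4) by simp
    also have "\<dots>\<^sup>2 \<le> (sqrt K * dist z0 z1)\<^sup>2"
      using curve_length_nonneg[of \<gamma>] g(4) by (intro power_mono riem_dist_le_coordinate_dist[OF mb z0r z(2)]) auto
    finally have "coord_metric M p (?c t) (c' t) (c' t) \<le> K * (dist z0 z1)\<^sup>2"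
      using mK by (simp add: power_mult_distrib)
    then show ?thesis
      unfolding \<kappa>_def using Osub(2)[OF t(2)] by (intro coordinate_velocity_le[OF mb]) auto
  qed
  \<comment> \<open>The speed bound is available only inside \<open>O'\<close>, so argue by first
    exit: before the exit time \<open>T\<close> the curve lies in the closed set \<open>C'\<close>,
    hence so does its point at \<open>T\<close>, which is then still in \<open>O'\<close>.\<close>
  have inO: "\<gamma> t \<in> O'" if t: "t \<in> {0..1}" for t
  proof (rule ccontr)
    assume notin: "\<gamma> t \<notin> O'"
    define B where "B = {0..1} \<inter> \<gamma> -` (- O')"
    define T where "T = Inf B"
    have B: "B \<noteq> {}" "bdd_below B" using notin t by (auto simp: B_def intro!: bdd_belowI[of _ 0])
    have "closed B" unfolding B_def using cont \<open>open O'\<close> by (intro continuous_closed_preimage) auto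
    then have TB: "T \<in> B" unfolding T_def using B closed_contains_Inf by blast
    have below: "\<gamma> s \<in> O'" if "0 \<le> s" "s < T" for s
      using cInf_lower[of s B] that TB B(2) unfolding T_def B_def by force
    have T: "T \<in> {0..1}" "\<gamma> T \<notin> O'" using TB by (auto simp: B_def)
    have "\<gamma> 0 \<in> O'" using g(2) z0 by (auto simp: O'_def)
    then have "0 < T" using T by (cases "T = 0") auto
    have "\<gamma> s \<in> C'" if s: "s \<in> {0..<T}" for s
    proof -
      have s1: "{0..s} \<subseteq> {0..1}" using s T by auto
      have "norm (?c s - ?c 0) \<le> \<kappa> * (s - 0)"
      proof (rule vector_derivative_bound)
        fix t assume t: "t \<in> {0..s}"
        then have t1: "t \<in> {0..1}" "\<gamma> t \<in> O'" using s1 s below[of t] by auto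
        show "(?c has_vector_derivative c' t) (at t within {0..s})"
          by (rule has_vector_derivative_within_subset[OF c(1)[OF t1(1) Osub(1)[OF t1(2)]] s1])
        show "norm (c' t) \<le> \<kappa>" by (rule speed[OF t1])
      qed (use s in auto)
      also have "\<dots> \<le> \<kappa> * 1" using s T mK by (intro mult_left_mono) (auto simp: \<kappa>_def)
      also have "\<dots> \<le> r / 4" using short by (simp add: \<kappa>_def)
      finally have "dist (?c 0) (?c s) \<le> r / 4" by (simp add: dist_norm norm_minus_commute)
      moreover have "?c 0 = z0" using g(2) z0 ballsub by (auto intro!: chart_chart_inv)
      ultimately have "dist a (?c s) \<le> 3 * r / 4"
        using z(1) dist_triangle[of a "?c s" z0] by simp
      moreover have "\<gamma> s \<in> chart_dom M p" using below[of s] s Osub by auto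
      ultimately show ?thesis unfolding C'_def by (intro image_eqI[of _ _ "?c s"]) auto
    qed
    then have "{0..<T} \<subseteq> {0..1} \<inter> \<gamma> -` C'" using T by auto
    moreover have "closed ({0..1} \<inter> \<gamma> -` C')"
      using cont \<open>closed C'\<close> by (intro continuous_closed_preimage) auto
    ultimately have "closure {0..<T} \<subseteq> {0..1} \<inter> \<gamma> -` C'" by (rule closure_minimal)
    then have "T \<in> \<gamma> -` C'" using \<open>0 < T\<close> by (auto simp: subset_iff)
    then have "\<gamma> T \<in> C'" by simp
    then show False using T CO by blast
  qed
  have dom: "\<gamma> t \<in> chart_dom M p" if "t \<in> {0..1}" for t using Osub inO that by blast
  let ?A = "K / m * \<kappa>\<^sup>2"
  have acc: "norm (c'' t) \<le> ?A" if t: "t \<in> {0..1}" for t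
  proof -
    have "norm (c'' t) \<le> K / m * (norm (c' t))\<^sup>2"
      using Osub(2)[OF inO[OF t]] c(3)[OF t dom[OF t]] by (intro geodesic_eq_norm_le[OF mb]) auto
    also have "\<dots> \<le> ?A" using speed[OF t inO[OF t]] mK by (intro mult_left_mono power_mono) auto
    finally show ?thesis .
  qed
  have A0: "0 \<le> ?A" using mK by simp
  have dev: "norm (c' t - c' 0) \<le> ?A" if t: "t \<in> {0..1}" for t
  proof -
    have sub: "{0..t} \<subseteq> {0..1}" using t by auto
    have "norm (c' t - c' 0) \<le> ?A * (t - 0)"
      using t sub by (intro vector_derivative_bound[where f' = c''] acc
          has_vector_derivative_within_subset[OF c(2) sub] dom) auto
    also have "\<dots> \<le> ?A * 1" using A0 t by (intro mult_left_mono) auto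
    finally show ?thesis by simp
  qed
  have "norm ((?c 1 - 1 *\<^sub>R c' 0) - (?c 0 - 0 *\<^sub>R c' 0)) \<le> ?A * (1 - 0)"
  proof (rule vector_derivative_bound)
    fix t :: real assume t: "t \<in> {0..1}"
    show "((\<lambda>t. ?c t - t *\<^sub>R c' 0) has_vector_derivative c' t - c' 0) (at t within {0..1})"
      by (intro has_vector_derivative_diff c(1) t dom)
        (auto intro!: derivative_eq_intros simp: has_vector_derivative_def)
    show "norm (c' t - c' 0) \<le> ?A" by (rule dev[OF t])
  qed simp
  moreover have "?c 0 = z0" "?c 1 = z1"
    using g(2,3) z0r z(2) sub by (auto intro!: chart_chart_inv)
  ultimately have "norm (z1 - c' 0 - z0) \<le> ?A" by simp
  moreover have "z1 - c' 0 - z0 = - (c' 0 - (z1 - z0))" by simp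
  \<comment> \<open>One factor \<open>K / m\<close> comes from the acceleration bound, the other
    from \<open>\<kappa>\<^sup>2\<close>.\<close>
  moreover have "?A = (K / m)\<^sup>2 * (dist z0 z1)\<^sup>2"
  proof -
    have "\<kappa>\<^sup>2 = K / m * (dist z0 z1)\<^sup>2" using mK by (simp add: \<kappa>_def power_mult_distrib)
    then show ?thesis by (simp add: power2_eq_square[of "K / m"])
  qed
  ultimately have "norm (c' 0 - (z1 - z0)) \<le> (K / m)\<^sup>2 * (dist z0 z1)\<^sup>2"
    by (simp only: norm_minus_cancel)
  then show ?thesis using c(1)[OF _ dom, of 0] by (intro exI[of _ "c' 0"]) simp
qed

text \<open>Quantifying over all \<open>w\<close> expresses, without a dual norm, that
  \<open>v\<close> decreases the form given by \<open>g\<close> by at least \<open>c\<close> times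
  its best slope per unit length. The constant is uniform in \<open>x\<close> because the
  displacement behind \<open>v\<close> has a fixed coordinate size when the form is nonzero.\<close>

lemma uniform_feasible_descent:
  assumes conv: "weakly_geodesically_convex M X"
    and "\<beta> > 0" and ball: "{y. riem_dist M x0 y \<le> \<beta>} \<subseteq> X"
  shows "\<exists>W c. open W \<and> x0 \<in> W \<and> c > 0 \<and>
    (\<forall>x\<in>W. \<forall>g. \<exists>v\<in>feasible_velocities M X x. \<forall>w. c * (- metric M x g w) \<le> tnorm M x w * (- metric M x g v))"
proof -
  define z where "z = chart M x0 x0"
  obtain r m K where r: "r > 0" and mb: "metric_bounds x0 (cball z r) m K"
    using metric_bounds_around[of x0] unfolding z_def by blast
  have mK: "0 < m" "0 < K" and sub: "cball z r \<subseteq> chart M x0 ` chart_dom M x0"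
    using metric_boundsD[OF mb] by auto
  define q where "q = K / m"
  have q: "q > 0" using mK by (simp add: q_def)
  \<comment> \<open>Points within coordinate distance \<open>s\<close> of the optimizer are within
    \<open>\<beta>\<close> in \<open>riem_dist\<close>, hence in \<open>X\<close>.\<close>
  define s where "s = min r (\<beta> / sqrt K)"
  have s: "s > 0" "s \<le> r" "sqrt K * s \<le> \<beta>"
    using r \<open>\<beta> > 0\<close> mK by (auto simp: s_def min_def field_simps)
  \<comment> \<open>In this order: targets from points of \<open>W\<close> stay within
    \<open>s\<close> of the centre, the geodesic is short enough to stay in the chart, and the
    quadratic error is at most \<open>\<epsilon> / 2\<close>.\<close>
  define \<epsilon> where "\<epsilon> = min (s / 2) (min (r / (4 * sqrt q)) (1 / (2 * q\<^sup>2)))"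
  have \<epsilon>: "\<epsilon> > 0" "\<epsilon> \<le> s / 2" using r s q by (auto simp: \<epsilon>_def)
  have \<epsilon>2: "sqrt q * \<epsilon> \<le> r / 4"
  proof -
    have "\<epsilon> \<le> r / (4 * sqrt q)" by (simp add: \<epsilon>_def)
    then show ?thesis using q by (simp add: field_simps)
  qed
  have \<epsilon>3: "q\<^sup>2 * \<epsilon>\<^sup>2 \<le> \<epsilon> / 2"
  proof -
    have "\<epsilon> \<le> 1 / (2 * q\<^sup>2)" by (simp add: \<epsilon>_def)
    then have "q\<^sup>2 * \<epsilon> \<le> 1 / 2" using q by (simp add: field_simps)
    then have "q\<^sup>2 * \<epsilon> * \<epsilon> \<le> 1 / 2 * \<epsilon>" using \<epsilon> by (intro mult_right_mono) auto
    then show ?thesis by (simp add: power2_eq_square mult_ac)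
  qed
  have inX: "chart_inv M x0 y \<in> X" if "y \<in> cball z s" for y
  proof -
    have "riem_dist M (chart_inv M x0 z) (chart_inv M x0 y) \<le> sqrt K * dist z y"
      using that r s by (intro riem_dist_le_coordinate_dist[OF mb]) auto
    also have "\<dots> \<le> sqrt K * s" using that mK by (intro mult_left_mono) auto
    finally show ?thesis using s(3) ball by (auto simp: z_def)
  qed
  define W where "W = chart_inv M x0 ` ball z (s / 2)"
  \<comment> \<open>\<open>\<epsilon> / 2\<close> is the guaranteed decrease per unit of
    \<open>norm b\<close>; \<open>sqrt m\<close> compares the coordinate norm of \<open>w\<close>
    with its Riemannian norm.\<close>
  define c where "c = \<epsilon> / 2 * sqrt m"
  have bsub: "ball z (s / 2) \<subseteq> cball z r" using s by (auto intro!: order_trans[OF ball_subset_cball])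
  show ?thesis
  proof (intro exI conjI ballI allI)
    show "open W" unfolding W_def using bsub sub by (intro open_chart_inv_image) auto
    show "x0 \<in> W" unfolding W_def using s by (intro image_eqI[of _ _ z]) (auto simp: z_def)
    show "c > 0" using \<epsilon> mK by (simp add: c_def)
    fix x g assume "x \<in> W"
    then obtain zx where zx: "zx \<in> ball z (s / 2)" "x = chart_inv M x0 zx" unfolding W_def by blast
    have zI: "zx \<in> cball z r" "zx \<in> chart M x0 ` chart_dom M x0" using zx bsub sub by auto
    have cx: "chart M x0 x = zx" "x \<in> chart_dom M x0" using zx(2) zI(2) chart_inv_in_dom by auto
    have xX: "x \<in> X" using zx inX s by auto
    let ?T = "tangent_map x0 x zx"
    define F where "F u = metric M x g (?T u)" for u
    have T: "linear ?T" using linear_tangent_map[OF cx(2) in_chart_dom] cx by simp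
    have linF: "linear F"
      unfolding F_def using linear_compose[OF T, of "metric M x g"] bilinear_metric[of x]
      by (simp add: bilinear_def o_def)
    \<comment> \<open>The Euclidean gradient in coordinates: \<open>b\<close> represents
      \<open>F\<close> in the standard inner product.\<close>
    define b where "b = (\<Sum>i\<in>Basis. F i *\<^sub>R i)"
    have Fb: "F u = b \<bullet> u" for u
    proof -
      have "F u = F (\<Sum>i\<in>Basis. (u \<bullet> i) *\<^sub>R i)" by (simp add: euclidean_representation)
      also have "\<dots> = (\<Sum>i\<in>Basis. (u \<bullet> i) * F i)" by (simp add: linear_sum[OF linF] linear_scale[OF linF])
      also have "\<dots> = b \<bullet> u" by (simp add: b_def inner_sum_left inner_commute[of u] mult.commute)
      finally show ?thesis .
    qed
    have upper: "sqrt m * (- metric M x g w) \<le> norm b * tnorm M x w" for w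
    proof -
      let ?u = "tangent_map x x0 (chart M x x) w"
      have Tu: "?T ?u = w" using tangent_map_inverse[OF in_chart_dom cx(2)] cx by simp
      have "m * (norm ?u)\<^sup>2 \<le> coord_metric M x0 zx ?u ?u" by (rule metric_boundsD(4)[OF mb zI(1)])
      also have "\<dots> = (tnorm M x w)\<^sup>2"
        using coord_metric_chart[OF cx(2)] cx(1) Tu by (simp add: tnorm_power2)
      finally have "sqrt (m * (norm ?u)\<^sup>2) \<le> tnorm M x w" by (intro real_le_lsqrt) (auto simp: tnorm_nonneg)
      then have n: "sqrt m * norm ?u \<le> tnorm M x w" by (simp add: real_sqrt_mult)
      have "- metric M x g w = - (b \<bullet> ?u)" using Fb[of ?u] by (simp add: F_def Tu)
      also have "\<dots> \<le> norm b * norm ?u" using norm_cauchy_schwarz[of "- b" ?u] by simp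
      finally have "sqrt m * (- metric M x g w) \<le> sqrt m * (norm b * norm ?u)"
        using mK by (intro mult_left_mono) auto
      also have "\<dots> = norm b * (sqrt m * norm ?u)" by simp
      also have "\<dots> \<le> norm b * tnorm M x w" by (intro mult_left_mono n) auto
      finally show ?thesis .
    qed
    have "\<exists>v\<in>feasible_velocities M X x. \<epsilon> / 2 * norm b \<le> - metric M x g v"
    proof -
      \<comment> \<open>The target point lies at coordinate distance at most \<open>\<epsilon>\<close> in the direction of steepest
        descent; the quadratic error \<open>q\<^sup>2 \<epsilon>\<^sup>2\<close> of the initial velocity costs at most half of the decrease.
        If \<open>b = 0\<close>, then \<open>sgn b = 0\<close> and the target point is \<open>x\<close> itself.\<close>
      define zy where "zy = zx - \<epsilon> *\<^sub>R sgn b"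
      have d: "dist zx zy \<le> \<epsilon>" using \<epsilon> by (simp add: zy_def dist_norm norm_sgn)
      have "dist z zy \<le> s" using dist_triangle[of z zy zx] d zx(1) \<epsilon> by simp
      then have zy: "zy \<in> cball z s" "zy \<in> cball z r" using s by auto
      obtain \<gamma> where \<gamma>: "minimizing_geodesic M x (chart_inv M x0 zy) \<gamma>" "\<gamma> ` {0..1} \<subseteq> X"
        using conv xX inX[OF zy(1)] unfolding weakly_geodesically_convex_def by blast
      have "sqrt (K / m) * dist zx zy \<le> sqrt q * \<epsilon>"
        using d q by (auto simp: q_def intro!: mult_left_mono)
      then have "\<exists>u. ((\<lambda>s. chart M x0 (\<gamma> s)) has_vector_derivative u) (at 0 within {0..1}) \<and>
          norm (u - (zy - zx)) \<le> (K / m)\<^sup>2 * (dist zx zy)\<^sup>2"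
        using \<epsilon>2 \<gamma>(1) zx zy s by (intro short_minimizing_geodesic[OF mb r]) auto
      then obtain u where u: "((\<lambda>s. chart M x0 (\<gamma> s)) has_vector_derivative u) (at 0 within {0..1})"
        "norm (u - (zy - zx)) \<le> q\<^sup>2 * (dist zx zy)\<^sup>2" unfolding q_def by blast
      have "q\<^sup>2 * (dist zx zy)\<^sup>2 \<le> q\<^sup>2 * \<epsilon>\<^sup>2" using d by (intro mult_left_mono power_mono) auto
      then have err: "norm (u - (zy - zx)) \<le> \<epsilon> / 2" using u(2) \<epsilon>3 by linarith
      define v where "v = velocity M {0..1} \<gamma> 0"
      have g: "geodesic_on M {0..1} \<gamma>" "\<gamma> 0 = x" using \<gamma>(1) unfolding minimizing_geodesic_def by auto
      have "v = ?T u"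
        unfolding v_def using velocity_eq(1)[OF zero_less_one _ geodesic_on_continuous[OF g(1)] _ u(1)] g(2) cx by simp
      then have "- metric M x g v = - (b \<bullet> u)" using Fb[of u] by (simp add: F_def)
      also have "\<dots> = - (b \<bullet> (zy - zx)) - b \<bullet> (u - (zy - zx))" by (simp add: inner_diff_right)
      also have "- (b \<bullet> (zy - zx)) = \<epsilon> * norm b"
        by (simp add: zy_def sgn_div_norm dot_square_norm power2_eq_square field_simps)
      finally have "\<epsilon> * norm b - b \<bullet> (u - (zy - zx)) \<le> - metric M x g v" by simp
      moreover have "b \<bullet> (u - (zy - zx)) \<le> norm b * (\<epsilon> / 2)"
        by (intro order_trans[OF norm_cauchy_schwarz] mult_left_mono err) auto
      ultimately have "\<epsilon> / 2 * norm b \<le> - metric M x g v" by (simp add: field_simps)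
      then show ?thesis using minimizing_geodesic_feasible(1)[OF \<gamma>] unfolding v_def by blast
    qed
    then obtain v where v: "v \<in> feasible_velocities M X x" "\<epsilon> / 2 * norm b \<le> - metric M x g v" by blast
    show "\<exists>v\<in>feasible_velocities M X x. \<forall>w. c * (- metric M x g w) \<le> tnorm M x w * (- metric M x g v)"
    proof (intro bexI[OF _ v(1)] allI)
      fix w
      have "c * (- metric M x g w) = \<epsilon> / 2 * (sqrt m * (- metric M x g w))" by (simp add: c_def)
      also have "\<dots> \<le> \<epsilon> / 2 * (norm b * tnorm M x w)" using \<epsilon> by (intro mult_left_mono upper) auto
      also have "\<dots> = tnorm M x w * (\<epsilon> / 2 * norm b)" by simp
      also have "\<dots> \<le> tnorm M x w * (- metric M x g v)" by (intro mult_left_mono v(2) tnorm_nonneg)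
      finally show "c * (- metric M x g w) \<le> tnorm M x w * (- metric M x g v)" .
    qed
  qed
qed

end

section \<open>The open-loop Frank-Wolfe method\<close>

text \<open>Induction gives the rate \<open>B / (k + a)\<close>. With \<open>n = k + a\<close>, the
  condition \<open>a > 2\<close> yields \<open>(n + 1) * (1 - a / n) \<le> n - 1\<close>; the spare
  \<open>B / n\<close> pays for the error.\<close>

lemma open_loop_recursion_tendsto_0:
  fixes h :: "nat \<Rightarrow> real"
  assumes a: "a > 2" and C: "C \<ge> 0" and h: "\<And>k. h k \<ge> 0"
    and rec: "\<And>k. h (Suc k) \<le> (1 - a / (real k + a)) * h k + C * (a / (real k + a))\<^sup>2"
  shows "h \<longlonglongrightarrow> 0"
proof -
  \<comment> \<open>The first entry starts the induction; the second dominates the error, using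
    \<open>(n + 1) / n \<le> 2\<close>.\<close>
  define B where "B = max (a * h 0) (2 * C * a\<^sup>2)"
  have bound: "(real k + a) * h k \<le> B" for k
  proof (induction k)
    case 0
    then show ?case by (simp add: B_def)
  next
    case (Suc k)
    define n where "n = real k + a"
    have n: "n \<ge> a" "n > 2" using a by (auto simp: n_def)
    have hB: "h k \<le> B / n" using Suc n by (simp add: n_def field_simps)
    have coef: "(n + 1) * (1 - a / n) \<le> n - 1" "0 \<le> (n + 1) * (1 - a / n)"
    proof -
      have "(n + 1) * (1 - a / n) = n + 1 - a - a / n" using n by (simp add: field_simps)
      also have "\<dots> \<le> n - 1" using n a divide_nonneg_pos[of a n] by linarith
      finally show "(n + 1) * (1 - a / n) \<le> n - 1" .
      show "0 \<le> (n + 1) * (1 - a / n)" using n by simp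
    qed
    have B: "0 \<le> B" "2 * C * a\<^sup>2 \<le> B" using a h[of 0] by (auto simp: B_def le_max_iff_disj)
    have "(real (Suc k) + a) * h (Suc k) \<le> (n + 1) * ((1 - a / n) * h k + C * (a / n)\<^sup>2)"
      using rec[of k] n unfolding n_def by (simp add: add_ac mult_left_mono)
    also have "\<dots> = ((n + 1) * (1 - a / n)) * h k + C * a\<^sup>2 * ((n + 1) / n) / n"
      by (simp add: power2_eq_square distrib_left distrib_right mult_ac)
    also have "\<dots> \<le> (n - 1) * (B / n) + C * a\<^sup>2 * 2 / n"
    proof (intro add_mono divide_right_mono mult_left_mono)
      have "((n + 1) * (1 - a / n)) * h k \<le> ((n + 1) * (1 - a / n)) * (B / n)"
        using hB coef(2) by (rule mult_left_mono)
      also have "\<dots> \<le> (n - 1) * (B / n)" using coef(1) B n by (intro mult_right_mono) auto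
      finally show "((n + 1) * (1 - a / n)) * h k \<le> (n - 1) * (B / n)" .
    qed (use n C in \<open>auto simp: field_simps\<close>)
    also have "\<dots> = B - (B - 2 * C * a\<^sup>2) / n" using n by (simp add: field_simps)
    also have "\<dots> \<le> B" using B n by simp
    finally show ?case .
  qed
  have "filterlim (\<lambda>k. a + real k) at_top sequentially"
    by (intro filterlim_tendsto_add_at_top[OF tendsto_const] filterlim_real_sequentially)
  then have "(\<lambda>k. B / (a + real k)) \<longlonglongrightarrow> 0"
    by (intro tendsto_divide_0[OF tendsto_const] filterlim_at_top_imp_at_infinity)
  then have "(\<lambda>k. B / (real k + a)) \<longlonglongrightarrow> 0" by (simp add: add.commute)
  then show ?thesis
  proof (rule tendsto_sandwich[rotated 2, OF tendsto_const])
    have "h k \<le> B / (real k + a)" for k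
      using bound[of k] a by (simp add: field_simps)
    then show "\<forall>\<^sub>F k in sequentially. h k \<le> B / (real k + a)" by simp
  qed (use h in simp)
qed

text \<open>Using the weights \<open>2 / a\<close> and \<open>1 - 2 / a\<close> on the two lower bounds for the gap, the first one
  exactly offsets the growth of \<open>(k + a)\<^sup>2\<close>, while the second one dominates the quadratic error.\<close>

lemma open_loop_recursion_quadratic_rate:
  fixes h g :: "nat \<Rightarrow> real"
  assumes a: "a > 2" and C: "C \<ge> 0" and c: "c > 0" and h: "\<And>k. h k \<ge> 0"
    and rec: "\<And>k. h (Suc k) \<le> h k - a / (real k + a) * g k + C * (a / (real k + a))\<^sup>2"
    and gap: "\<And>k. h k \<le> g k" "\<And>k. k \<ge> k0 \<Longrightarrow> c * sqrt (h k) \<le> g k"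
  shows "\<exists>B. \<forall>k\<ge>k0. (real k + a)\<^sup>2 * h k \<le> B"
proof -
  define l where "l = 1 - 2 / a"
  have l: "l > 0" "l * a = a - 2" using a by (auto simp: l_def field_simps)
  \<comment> \<open>The threshold for \<open>b = (k + a) * sqrt (h k)\<close> from which the gain
    \<open>l * c * a * b\<close> covers the error \<open>C * a\<^sup>2\<close>.\<close>
  define b0 where "b0 = C * a / (l * c)"
  \<comment> \<open>Below the threshold a step adds at most \<open>4 * C * a\<^sup>2\<close>,
    because \<open>(n + 1)\<^sup>2 / n\<^sup>2 \<le> 4\<close>; above it the scaled value does not
    increase.\<close>
  define B where "B = max ((real k0 + a)\<^sup>2 * h k0) (b0\<^sup>2 + 4 * C * a\<^sup>2)"
  have "(real k + a)\<^sup>2 * h k \<le> B" if "k \<ge> k0" for k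
    using that
  proof (induction k rule: dec_induct)
    case base
    then show ?case by (simp add: B_def)
  next
    case (step k)
    define n where "n = real k + a"
    define b where "b = n * sqrt (h k)"
    have n: "n > 2" using a by (simp add: n_def)
    have b: "b \<ge> 0" "b\<^sup>2 = n\<^sup>2 * h k" using n h[of k] by (auto simp: b_def power_mult_distrib)
    have "2 / a * h k + l * (c * sqrt (h k)) \<le> 2 / a * g k + l * g k"
      using gap[of k] step.hyps l a by (intro add_mono mult_left_mono) auto
    also have "\<dots> = g k" by (simp add: l_def field_simps)
    finally have "a / n * (2 / a * h k + l * (c * sqrt (h k))) \<le> a / n * g k"
      using a n by (intro mult_left_mono) auto
    then have "h (Suc k) \<le> h k - a / n * (2 / a * h k + l * (c * sqrt (h k))) + C * (a / n)\<^sup>2"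
      using rec[of k] unfolding n_def by linarith
    also have "\<dots> = ((1 - 2 / n) * b\<^sup>2 + (C * a\<^sup>2 - l * c * a * b)) / n\<^sup>2"
      using n a h[of k] unfolding b(2) by (simp add: b_def power2_eq_square field_simps)
    finally have "(n + 1)\<^sup>2 * h (Suc k) \<le> (n + 1)\<^sup>2 * (((1 - 2 / n) * b\<^sup>2 + (C * a\<^sup>2 - l * c * a * b)) / n\<^sup>2)"
      by (intro mult_left_mono) auto
    also have "\<dots> = ((n + 1)\<^sup>2 / n\<^sup>2 * (1 - 2 / n)) * b\<^sup>2 + (n + 1)\<^sup>2 / n\<^sup>2 * (C * a\<^sup>2 - l * c * a * b)"
      by (simp add: add_divide_distrib distrib_left)
    also have "\<dots> \<le> 1 * b\<^sup>2 + (n + 1)\<^sup>2 / n\<^sup>2 * (C * a\<^sup>2 - l * c * a * b)"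
    proof (intro add_right_mono mult_right_mono)
      have "(n + 1)\<^sup>2 * (n - 2) = n * n\<^sup>2 - 3 * n - 2" by (simp add: power2_eq_square algebra_simps)
      then have "(n + 1)\<^sup>2 * (n - 2) \<le> n * n\<^sup>2" using n by linarith
      then show "(n + 1)\<^sup>2 / n\<^sup>2 * (1 - 2 / n) \<le> 1" using n by (simp add: field_simps)
    qed simp
    also have "\<dots> \<le> B"
    proof (cases "b0 \<le> b")
      case True
      have "C * a\<^sup>2 = (l * c * a) * b0" using l c by (simp add: b0_def power2_eq_square)
      also have "\<dots> \<le> l * c * a * b" using True l c a by (intro mult_left_mono) auto
      finally have "(n + 1)\<^sup>2 / n\<^sup>2 * (C * a\<^sup>2 - l * c * a * b) \<le> 0" by (intro mult_nonneg_nonpos) auto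
      moreover have "b\<^sup>2 \<le> B" using step.IH b(2) by (simp add: n_def)
      ultimately show ?thesis by linarith
    next
      case False
      have "(n + 1)\<^sup>2 \<le> (2 * n)\<^sup>2" using n by (intro power_mono) auto
      then have "(n + 1)\<^sup>2 / n\<^sup>2 \<le> 4" using n by (simp add: field_simps)
      have "(n + 1)\<^sup>2 / n\<^sup>2 * (C * a\<^sup>2 - l * c * a * b) \<le> (n + 1)\<^sup>2 / n\<^sup>2 * (C * a\<^sup>2)"
        using l c a b(1) by (intro mult_left_mono) auto
      also have "\<dots> \<le> 4 * (C * a\<^sup>2)" using \<open>_ \<le> 4\<close> C by (intro mult_right_mono) auto
      finally have "(n + 1)\<^sup>2 / n\<^sup>2 * (C * a\<^sup>2 - l * c * a * b) \<le> 4 * C * a\<^sup>2" by simp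
      moreover have "b\<^sup>2 \<le> b0\<^sup>2" using False b(1) by (intro power_mono) auto
      ultimately show ?thesis by (simp add: B_def)
    qed
    finally show ?case by (simp add: n_def add_ac)
  qed
  then show ?thesis by blast
qed

section \<open>Quadratic growth and lower bounds for the gap\<close>

locale strongly_convex_problem = riemannian M
  for M :: "('m::{t2_space, second_countable_topology}, 'e::euclidean_space) riem" +
  fixes X :: "'m set" and f :: "'m \<Rightarrow> real" and L \<mu> \<beta> :: real and xstar :: 'm
  assumes compact: "compact X" and convex: "weakly_geodesically_convex M X"
    and differentiable: "x \<in> X \<Longrightarrow> differentiable_at M f x"
    and regularity: "regularity M X f L" and L_pos: "L > 0"
    and argmin: "argmin_set X f = {xstar}"
    and \<beta>_pos: "\<beta> > 0" and interior_ball: "{y. riem_dist M xstar y \<le> \<beta>} \<subseteq> X"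
    and \<mu>_pos: "\<mu> > 0" and strong_convexity: "strongly_geodesically_convex M X f \<mu>"
begin

lemma xstar: "xstar \<in> X" "y \<in> X \<Longrightarrow> f xstar \<le> f y"
proof -
  have "is_arg_min f (\<lambda>y. y \<in> X) xstar" using argmin unfolding argmin_set_def by blast
  then show "xstar \<in> X" "y \<in> X \<Longrightarrow> f xstar \<le> f y" unfolding is_arg_min_linorder by auto
qed

lemma xstar_unique: "x \<in> X \<Longrightarrow> f x \<le> f xstar \<Longrightarrow> x = xstar"
proof -
  assume "x \<in> X" "f x \<le> f xstar"
  then have "is_arg_min f (\<lambda>y. y \<in> X) x" unfolding is_arg_min_linorder using xstar(2) order_trans by blast
  then show "x = xstar" using argmin unfolding argmin_set_def by blast
qed

lemma fmin_eq: "fmin X f = f xstar"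
  unfolding fmin_def by (rule cInf_eq_minimum) (use xstar in auto)

lemma continuous_f: "continuous_on X f"
  by (intro continuous_at_imp_continuous_on ballI differentiable_at_isCont differentiable)

text \<open>By the convexity part of \<open>regularity\<close>, \<open>f\<close> stays below its
  chord along the geodesic. Difference quotients at 0 are therefore at most
  \<open>f y - f x\<close>, and so is their limit, the directional derivative.\<close>

lemma feasible_velocity_between:
  assumes x: "x \<in> X" and y: "y \<in> X"
  shows "\<exists>w\<in>feasible_velocities M X x. Exp M x w = y \<and> tnorm M x w = riem_dist M x y \<and>
    metric M x (grad M f x) w \<le> f y - f x"
proof -
  obtain \<gamma> where \<gamma>: "minimizing_geodesic M x y \<gamma>" "\<gamma> ` {0..1} \<subseteq> X"
    using convex x y unfolding weakly_geodesically_convex_def by blast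
  define w where "w = velocity M {0..1} \<gamma> 0"
  note w = minimizing_geodesic_feasible[OF \<gamma>, folded w_def]
  have g: "geodesic_on M {0..1} \<gamma>" "\<gamma> 0 = x" using \<gamma>(1) unfolding minimizing_geodesic_def by auto
  obtain c' c'' where c: "\<And>t. t \<in> {0..1} \<Longrightarrow> \<gamma> t \<in> chart_dom M x \<Longrightarrow>
      ((\<lambda>s. chart M x (\<gamma> s)) has_vector_derivative c' t) (at t within {0..1})"
    by (rule geodesic_onE[OF g(1), of x], rule that)
  have c0: "((\<lambda>s. chart M x (\<gamma> s)) has_vector_derivative c' 0) (at 0 within {0..1})"
    using c[of 0] g(2) by simp
  have dom: "\<gamma> 0 \<in> chart_dom M x" using g(2) by simp
  have wc: "w = tangent_map x (\<gamma> 0) (chart M x (\<gamma> 0)) (c' 0)"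
    unfolding w_def using velocity_eq(1)[OF zero_less_one _ geodesic_on_continuous[OF g(1)] dom c0] by simp
  have "continuous (at 0 within {0..1}) \<gamma>"
    using geodesic_on_continuous[OF g(1)] by (simp add: continuous_on_eq_continuous_within)
  then have "((\<lambda>s. f (\<gamma> s)) has_real_derivative differential M f x w) (at 0 within {0..1})"
    using along_curve_has_derivative[OF _ _ _ dom c0, of f] differentiable[OF x] wc g(2) by simp
  then have "((\<lambda>t. (f (\<gamma> t) - f (\<gamma> 0)) / (t - 0)) \<longlongrightarrow> differential M f x w) (at 0 within {0..1})"
    unfolding has_field_derivative_iff .
  moreover have "\<forall>\<^sub>F t in at 0 within {0..1}. (f (\<gamma> t) - f (\<gamma> 0)) / (t - 0) \<le> f y - f x"
  proof -
    have "(f (\<gamma> t) - f x) / t \<le> f y - f x" if t: "t \<in> {0..1}" "t \<noteq> 0" for t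
    proof -
      have "f (\<gamma> t) \<le> (1 - t) * f x + t * f y"
        using regularity x w(1) t(1) w(3) w(4)[OF t(1)] unfolding regularity_def by metis
      then show ?thesis using t by (simp add: field_simps)
    qed
    then show ?thesis unfolding eventually_at using g(2) by (intro exI[of _ 1]) auto
  qed
  moreover have "at 0 within {0..1} \<noteq> (bot :: real filter)"
    using at_within_Icc_at_right[of 0 "1::real"] by simp
  ultimately have "differential M f x w \<le> f y - f x" by (rule tendsto_upperbound)
  then show ?thesis using w(1-3) metric_grad[OF differentiable[OF x]] by metis
qed

text \<open>Move from \<open>x\<close> towards \<open>xstar\<close> for time \<open>t\<close>:
  minimality of \<open>xstar\<close> and strong convexity leave a common factor
  \<open>1 - t\<close>. Cancel it and let \<open>t\<close> tend to 1.\<close>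

lemma quadratic_growth:
  assumes x: "x \<in> X"
  shows "\<mu> / 2 * (riem_dist M x xstar)\<^sup>2 \<le> f x - f xstar"
proof (rule field_le_mult_one_interval)
  fix t :: real assume t: "0 < t" "t < 1"
  obtain w where w: "w \<in> feasible_velocities M X x" "Exp M x w = xstar" "tnorm M x w = riem_dist M x xstar"
    using feasible_velocity_between[OF x xstar(1)] by blast
  have "f xstar \<le> f (Exp M x (t *\<^sub>R w))"
    using w(1) t by (intro xstar(2)) (auto simp: feasible_velocities_def)
  also have "\<dots> \<le> (1 - t) * f x + t * f xstar - \<mu> / 2 * t * (1 - t) * (riem_dist M x xstar)\<^sup>2"
    using strong_convexity x w t unfolding strongly_geodesically_convex_def by fastforce
  finally have "(1 - t) * (t * (\<mu> / 2 * (riem_dist M x xstar)\<^sup>2)) \<le> (1 - t) * (f x - f xstar)"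
    by (simp add: algebra_simps)
  then show "t * (\<mu> / 2 * (riem_dist M x xstar)\<^sup>2) \<le> f x - f xstar" using t by simp
qed

lemma riem_dist_xstar_le:
  assumes "x \<in> X"
  shows "riem_dist M x xstar \<le> sqrt (2 * (f x - f xstar) / \<mu>)"
  using quadratic_growth[OF assms] \<mu>_pos by (intro real_le_rsqrt) (simp add: field_simps)

text \<open>At the midpoint strong convexity gains \<open>\<mu> / 8 * (tnorm M x v)\<^sup>2\<close>,
  which cannot exceed the range of \<open>f\<close> on the compact set \<open>X\<close>. The bound
  \<open>R\<close> plays the part of the squared diameter in the descent inequality.\<close>

lemma feasible_velocities_bounded:
  "\<exists>R\<ge>0. \<forall>x\<in>X. \<forall>v\<in>feasible_velocities M X x. (tnorm M x v)\<^sup>2 \<le> R"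
proof -
  obtain y where y: "y \<in> X" "\<And>z. z \<in> X \<Longrightarrow> f z \<le> f y"
    using continuous_attains_sup[OF compact _ continuous_f] xstar(1) by blast
  have "(tnorm M x v)\<^sup>2 \<le> 8 / \<mu> * (f y - f xstar)"
    if x: "x \<in> X" and v: "v \<in> feasible_velocities M X x" for x v
  proof -
    have h: "(1 / 2 :: real) \<in> {0..1}" by simp
    have in_X: "Exp M x ((1 / 2) *\<^sub>R v) \<in> X" "Exp M x v \<in> X"
      using v h unfolding feasible_velocities_def by blast+
    have "f (Exp M x ((1 / 2) *\<^sub>R v))
        \<le> (1 - 1 / 2) * f x + 1 / 2 * f (Exp M x v) - \<mu> / 2 * (1 / 2) * (1 - 1 / 2) * (tnorm M x v)\<^sup>2"
      using strong_convexity x v h unfolding strongly_geodesically_convex_def by blast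
    moreover note xstar(2)[OF in_X(1)] y(2)[OF in_X(2)] y(2)[OF x]
    ultimately have "\<mu> * (tnorm M x v)\<^sup>2 \<le> 8 * (f y - f xstar)" by simp
    then show ?thesis using \<mu>_pos by (simp add: field_simps)
  qed
  moreover have "0 \<le> 8 / \<mu> * (f y - f xstar)" using \<mu>_pos xstar(2)[OF y(1)] by simp
  ultimately show ?thesis by blast
qed

text \<open>Compare with the direction \<open>w\<close> to \<open>xstar\<close>: gap at least
  \<open>h\<close>, length at most \<open>sqrt (2 * h / \<mu>)\<close>. The quotient is
  \<open>sqrt (\<mu> / 2) * sqrt h\<close>, of which \<open>uniform_feasible_descent\<close> retains
  the fraction \<open>c\<close>.\<close>

lemma local_gap_lower_bound:
  "\<exists>W c. open W \<and> xstar \<in> W \<and> c > 0 \<and>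
     (\<forall>x\<in>W \<inter> X. \<exists>v\<in>feasible_velocities M X x. c * sqrt (f x - f xstar) \<le> fw_gap M f x v)"
proof -
  obtain W c where W: "open W" "xstar \<in> W" "c > 0"
    and desc: "\<And>x g. x \<in> W \<Longrightarrow> \<exists>v\<in>feasible_velocities M X x. \<forall>w.
      c * (- metric M x g w) \<le> tnorm M x w * (- metric M x g v)"
    using uniform_feasible_descent[OF convex \<beta>_pos interior_ball] by blast
  have "\<exists>v\<in>feasible_velocities M X x. c * sqrt (\<mu> / 2) * sqrt (f x - f xstar) \<le> fw_gap M f x v"
    if x: "x \<in> W" "x \<in> X" for x
  proof -
    define h where "h = f x - f xstar"
    obtain w where w: "w \<in> feasible_velocities M X x" "tnorm M x w = riem_dist M x xstar"
      "metric M x (grad M f x) w \<le> - h"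
      using feasible_velocity_between[OF x(2) xstar(1)] unfolding h_def by fastforce
    have "h \<ge> 0" using xstar(2)[OF x(2)] by (simp add: h_def)
    show ?thesis
    proof (cases "h = 0")
      case True
      then show ?thesis using w(1,3) unfolding fw_gap_def h_def[symmetric] by (intro bexI[of _ w]) auto
    next
      case False
      then have "h > 0" using \<open>h \<ge> 0\<close> by simp
      obtain v where v: "v \<in> feasible_velocities M X x"
        "c * (- metric M x (grad M f x) w) \<le> tnorm M x w * fw_gap M f x v"
        using desc[OF x(1)] unfolding fw_gap_def by blast
      have "c * h \<le> c * (- metric M x (grad M f x) w)" using w(3) W(3) by (intro mult_left_mono) auto
      with v(2) have le: "c * h \<le> tnorm M x w * fw_gap M f x v" by linarith
      then have "0 < tnorm M x w * fw_gap M f x v" using \<open>h > 0\<close> W(3) by (smt (verit) mult_pos_pos)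
      \<comment> \<open>The sign permits replacing the norm of \<open>w\<close> by its upper bound
        in the product.\<close>
      then have "0 \<le> fw_gap M f x v" using tnorm_nonneg[of x w] by (simp add: zero_less_mult_iff)
      then have "tnorm M x w * fw_gap M f x v \<le> sqrt (2 * h / \<mu>) * fw_gap M f x v"
        using riem_dist_xstar_le[OF x(2)] w(2) unfolding h_def by (intro mult_right_mono) auto
      with le have "c * (sqrt h * sqrt h) \<le> sqrt (2 * h / \<mu>) * fw_gap M f x v" using \<open>h > 0\<close> by simp
      moreover have "sqrt (2 * h / \<mu>) = sqrt h / sqrt (\<mu> / 2)"
        by (simp add: real_sqrt_divide[symmetric] mult.commute)
      \<comment> \<open>Used with \<open>r = sqrt h\<close> and \<open>s = sqrt (\<mu> / 2)\<close>;
        the common factor \<open>r\<close> is cancelled afterwards.\<close>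
      moreover have "r * (c * s * r) \<le> r * G" if "c * (r * r) \<le> r / s * G" "s > 0" for r s G :: real
        using that by (simp add: field_simps)
      ultimately have "sqrt h * (c * sqrt (\<mu> / 2) * sqrt h) \<le> sqrt h * fw_gap M f x v"
        using \<mu>_pos by (metis half_gt_zero real_sqrt_gt_zero)
      then have "c * sqrt (\<mu> / 2) * sqrt h \<le> fw_gap M f x v" using \<open>h > 0\<close> by simp
      then show ?thesis using v(1) unfolding h_def by blast
    qed
  qed
  moreover have "c * sqrt (\<mu> / 2) > 0" using W(3) \<mu>_pos by simp
  ultimately show ?thesis using W(1,2) by (metis IntE)
qed

text \<open>On the compact set \<open>X - W\<close> the minimum of \<open>f\<close> exceeds
  \<open>f xstar\<close> by uniqueness of the optimizer; the excess serves as
  \<open>e\<close>.\<close>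

lemma sublevel_in_neighbourhood:
  assumes "open W" "xstar \<in> W"
  shows "\<exists>e>0. \<forall>x\<in>X. f x - f xstar < e \<longrightarrow> x \<in> W"
proof (cases "X - W = {}")
  case True
  then show ?thesis by (auto intro: exI[of _ 1])
next
  case False
  have "compact (X - W)" using compact assms(1) by (rule compact_diff)
  then obtain y where y: "y \<in> X - W" "\<And>x. x \<in> X - W \<Longrightarrow> f y \<le> f x"
    using continuous_attains_inf[of "X - W" f] False continuous_f continuous_on_subset by (metis Diff_subset)
  have "f xstar < f y" using xstar_unique[of y] y(1) assms(2) by force
  then show ?thesis using y(2) by (intro exI[of _ "f y - f xstar"]) force
qed

text \<open>The chosen direction maximises the gap among feasible ones, so lower bounds proved for
  some feasible direction pass to it.\<close>

lemma fw_gap_ge: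
  assumes x: "x \<in> X"
    and v: "is_arg_min (\<lambda>w. metric M x (grad M f x) w) (\<lambda>w. w \<in> feasible_velocities M X x) v"
  shows "f x - f xstar \<le> fw_gap M f x v"
    and "w \<in> feasible_velocities M X x \<Longrightarrow> fw_gap M f x w \<le> fw_gap M f x v"
proof -
  show le: "w \<in> feasible_velocities M X x \<Longrightarrow> fw_gap M f x w \<le> fw_gap M f x v" for w
    using v unfolding is_arg_min_linorder fw_gap_def by auto
  obtain w where "w \<in> feasible_velocities M X x" "metric M x (grad M f x) w \<le> f xstar - f x"
    using feasible_velocity_between[OF x xstar(1)] by blast
  then show "f x - f xstar \<le> fw_gap M f x v" using le[of w] unfolding fw_gap_def by linarith
qed

section \<open>Runs of the algorithm\<close>

lemma run_in_X:
  assumes run: "rfw_ol_run M X f a x v N" and a: "a > 0" and k: "enat k \<le> N"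
  shows "x k \<in> X"
  using k
proof (induction k)
  case 0
  then show ?case using run by (simp add: rfw_ol_run_def)
next
  case (Suc k)
  then have k: "enat k < N" by (simp add: Suc_ile_eq)
  have "v k \<in> feasible_velocities M X (x k)"
    using run k unfolding rfw_ol_run_def is_arg_min_def by (meson less_imp_le)
  moreover have "a / (real k + a) \<in> {0..1}" using a by simp
  moreover have "x (Suc k) = Exp M (x k) ((a / (real k + a)) *\<^sub>R v k)"
    using run k unfolding rfw_ol_run_def by blast
  ultimately show ?case unfolding feasible_velocities_def by auto
qed

lemma run_converges:
  assumes run: "rfw_ol_run M X f a x v \<infinity>" and a: "a > 2"
  shows "(\<lambda>k. f (x k) - f xstar) \<in> O(\<lambda>k. 1 / (real k)\<^sup>2)"
proof -
  define h where "h k = f (x k) - f xstar" for k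
  define g where "g k = fw_gap M f (x k) (v k)" for k
  have xX: "x k \<in> X" for k using run_in_X[OF run] a by simp
  have arg: "is_arg_min (\<lambda>w. metric M (x k) (grad M f (x k)) w) (\<lambda>w. w \<in> feasible_velocities M X (x k)) (v k)" for k
    using run unfolding rfw_ol_run_def by simp
  have feas: "v k \<in> feasible_velocities M X (x k)" for k using arg unfolding is_arg_min_def by blast
  have h0: "h k \<ge> 0" for k using xstar(2)[OF xX] by (simp add: h_def)
  have gh: "h k \<le> g k" for k unfolding h_def g_def by (rule fw_gap_ge(1)[OF xX arg])
  obtain R where R: "R \<ge> 0" "\<And>x v. x \<in> X \<Longrightarrow> v \<in> feasible_velocities M X x \<Longrightarrow> (tnorm M x v)\<^sup>2 \<le> R"
    using feasible_velocities_bounded by blast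
  define C where "C = L / 2 * R"
  have C: "C \<ge> 0" using L_pos R by (simp add: C_def)
  have rec: "h (Suc k) \<le> h k - a / (real k + a) * g k + C * (a / (real k + a))\<^sup>2" for k
  proof -
    let ?\<eta> = "a / (real k + a)"
    have \<eta>: "?\<eta> \<in> {0..1}" using a by simp
    have "x (Suc k) = Exp M (x k) (?\<eta> *\<^sub>R v k)" using run unfolding rfw_ol_run_def by simp
    moreover have "f (Exp M (x k) (?\<eta> *\<^sub>R v k))
        \<le> f (x k) + ?\<eta> * metric M (x k) (grad M f (x k)) (v k) + L / 2 * ?\<eta>\<^sup>2 * (tnorm M (x k) (v k))\<^sup>2"
      using regularity xX feas \<eta> unfolding regularity_def by blast
    moreover have "L / 2 * ?\<eta>\<^sup>2 * (tnorm M (x k) (v k))\<^sup>2 \<le> L / 2 * ?\<eta>\<^sup>2 * R"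
      using L_pos by (intro mult_left_mono R(2) xX feas) auto
    ultimately show ?thesis unfolding h_def g_def fw_gap_def C_def by (simp add: mult_ac)
  qed
  have "h \<longlonglongrightarrow> 0"
  proof (rule open_loop_recursion_tendsto_0[OF a C h0])
    fix k
    have "a / (real k + a) * h k \<le> a / (real k + a) * g k" using gh a by (intro mult_left_mono) auto
    then show "h (Suc k) \<le> (1 - a / (real k + a)) * h k + C * (a / (real k + a))\<^sup>2"
      using rec[of k] by (simp add: left_diff_distrib)
  qed
  obtain W c where W: "open W" "xstar \<in> W" and c: "c > 0"
    and gapW: "\<And>y. y \<in> W \<Longrightarrow> y \<in> X \<Longrightarrow> \<exists>v\<in>feasible_velocities M X y. c * sqrt (f y - f xstar) \<le> fw_gap M f y v"
    using local_gap_lower_bound by blast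
  obtain e where e: "e > 0" "\<And>y. y \<in> X \<Longrightarrow> f y - f xstar < e \<Longrightarrow> y \<in> W"
    using sublevel_in_neighbourhood[OF W] by blast
  have "\<forall>\<^sub>F k in sequentially. h k < e" using \<open>h \<longlonglongrightarrow> 0\<close> e(1) by (rule order_tendstoD)
  then obtain k0 where k0: "\<And>k. k \<ge> k0 \<Longrightarrow> h k < e" unfolding eventually_sequentially by blast
  have "c * sqrt (h k) \<le> g k" if "k \<ge> k0" for k
  proof -
    have "x k \<in> W" using e(2)[OF xX] k0[OF that] by (simp add: h_def)
    then obtain w where "w \<in> feasible_velocities M X (x k)" "c * sqrt (h k) \<le> fw_gap M f (x k) w"
      using gapW xX unfolding h_def by blast
    then show ?thesis using fw_gap_ge(2)[OF xX arg] unfolding g_def by fastforce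
  qed
  then obtain B where B: "\<And>k. k \<ge> k0 \<Longrightarrow> (real k + a)\<^sup>2 * h k \<le> B"
    using open_loop_recursion_quadratic_rate[OF a C c h0 rec gh] by blast
  show ?thesis
  proof (rule bigoI[where c = B])
    show "\<forall>\<^sub>F k in sequentially. norm (f (x k) - f xstar) \<le> B * norm (1 / (real k)\<^sup>2)"
      \<comment> \<open>The index 0 is excluded since \<open>1 / (real k)\<^sup>2\<close> is 0 there
        by convention.\<close>
      using eventually_ge_at_top[of "max k0 1"]
    proof eventually_elim
      case (elim k)
      have "(real k)\<^sup>2 * h k \<le> (real k + a)\<^sup>2 * h k" using a h0 by (intro mult_right_mono power_mono) auto
      also have "\<dots> \<le> B" using B elim by simp
      finally have "h k \<le> B / (real k)\<^sup>2" using elim by (simp add: field_simps)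
      then show ?case using h0[of k] by (simp add: h_def)
    qed
  qed
qed

end

theorem corollary5p10:
  fixes M :: "('m::{t2_space, second_countable_topology}, 'e::euclidean_space) riem"
    and X U :: "'m set" and f :: "'m \<Rightarrow> real" and L \<mu> \<beta> :: real and xstar :: 'm
  assumes manifold: "riemannian_manifold M" "connected (UNIV :: 'm set)" "complete_manifold M"
    and X: "X \<noteq> {}" "compact X" "diam M X > 0" "weakly_geodesically_convex M X"
    and f: "open U" "X \<subseteq> U" "\<forall>x\<in>U. differentiable_at M f x"
    and regularity: "L > 0" "regularity M X f L"
    and unique_optimizer: "argmin_set X f = {xstar}"
    and strict_interior: "\<beta> > 0" "{y. riem_dist M xstar y \<le> \<beta>} \<subseteq> X"
    and strong_convexity: "\<mu> > 0" "strongly_geodesically_convex M X f \<mu>"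
  shows "(\<forall>x\<in>X. riem_dist M x xstar \<le> sqrt (2 * (f x - fmin X f) / \<mu>)) \<and>
         hoelder_error_bound M X f (sqrt (2 / \<mu>)) (1 / 2) \<and>
         (\<forall>a>2. \<forall>x v N. rfw_ol_run M X f a x v N \<longrightarrow>
            (\<exists>K. N = enat K \<and> x K = xstar) \<or>
            (N = \<infinity> \<and> (\<lambda>k. f (x k) - fmin X f) \<in> O(\<lambda>k. 1 / (real k)\<^sup>2)))"
proof -
  interpret strongly_convex_problem M X f L \<mu> \<beta> xstar
    using assms by unfold_locales auto
  have bound: "\<forall>x\<in>X. riem_dist M x xstar \<le> sqrt (2 * (f x - fmin X f) / \<mu>)"
    using riem_dist_xstar_le by (simp add: fmin_eq)
  moreover have "hoelder_error_bound M X f (sqrt (2 / \<mu>)) (1 / 2)"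
    unfolding hoelder_error_bound_def
  proof
    fix x assume x: "x \<in> X"
    have "riem_dist M x xstar \<le> sqrt (2 * (f x - fmin X f) / \<mu>)" using bound x by blast
    also have "\<dots> = sqrt (2 / \<mu>) * (f x - fmin X f) powr (1 / 2)"
      using xstar(2)[OF x] by (simp add: fmin_eq powr_half_sqrt flip: real_sqrt_mult)
    finally show "(INF y\<in>argmin_set X f. riem_dist M x y) \<le> sqrt (2 / \<mu>) * (f x - fmin X f) powr (1 / 2)"
      using unique_optimizer by simp
  qed
  moreover have "(\<exists>K. N = enat K \<and> x K = xstar) \<or>
      (N = \<infinity> \<and> (\<lambda>k. f (x k) - fmin X f) \<in> O(\<lambda>k. 1 / (real k)\<^sup>2))"
    if a: "a > 2" and run: "rfw_ol_run M X f a x v N" for a x v N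
  proof (cases N)
    case (enat K)
    have K: "x K \<in> X" using run_in_X[OF run, of K] a enat by simp
    have "is_arg_min (\<lambda>w. metric M (x K) (grad M f (x K)) w) (\<lambda>w. w \<in> feasible_velocities M X (x K)) (v K)"
      and "fw_gap M f (x K) (v K) = 0"
      using run enat unfolding rfw_ol_run_def by auto
    \<comment> \<open>The vanishing gap bounds the optimality gap from above, so termination
      certifies optimality.\<close>
    then have "f (x K) \<le> f xstar" using fw_gap_ge(1)[OF K] by fastforce
    then show ?thesis using xstar_unique[OF K] enat by blast
  next
    case infinity
    then show ?thesis using run_converges a run fmin_eq by simp
  qed
  ultimately show ?thesis by blast
qed

end
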